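(* There exist absolute constants $C>0$ and $c>0$ such that the following holds. Let $S$ be a collection of $n$ $x$-monotone curves in general position with at least $\epsilon n^2$ touching pairs, where $\epsilon> C\sqrt{\log\log n/\log n}$. Then $S$ determines at least $c\,\epsilon n^2\sqrt{\log n/\log\log n}$ crossing points.
   Context: An $x$-monotone curve is a curve in the plane no two points of which have the same $x$-coordinate (not necessarily defined over the whole real line). A family of curves is in general position if no three curves pass through the same point and no two curves share infinitely many points. Two curves touch (form a touching pair) if they have precisely one point in common, at which they do not properly cross; this point is a touching point. All other common points of two curves are crossing points. *)

theory Defs
  imports "HOL-Analysis.Analysis"
begin

text \<open>
  Curves are point sets. The parameter interval need not be closed or bounded, so bounded arcs,
  rays and bi-infinite curves are all included; injectivity excludes one-point curves.
\<close>

definition curve :: "(real \<times> real) set \<Rightarrow> bool" where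
  "curve A \<longleftrightarrow> (\<exists>(I :: real set) \<gamma>. is_interval I \<and> interior I \<noteq> {} \<and>
      continuous_on I \<gamma> \<and> inj_on \<gamma> I \<and> A = \<gamma> ` I)"

definition x_monotone_curve :: "(real \<times> real) set \<Rightarrow> bool" where
  "x_monotone_curve A \<longleftrightarrow> curve A \<and> inj_on fst A"

definition general_position :: "(real \<times> real) set set \<Rightarrow> bool" where
  "general_position S \<longleftrightarrow>
     (\<forall>A\<in>S. \<forall>B\<in>S. \<forall>D\<in>S. A \<noteq> B \<and> A \<noteq> D \<and> B \<noteq> D \<longrightarrow> A \<inter> B \<inter> D = {}) \<and>
     (\<forall>A\<in>S. \<forall>B\<in>S. A \<noteq> B \<longrightarrow> finite (A \<inter> B))"

definition below_at :: "(real \<times> real) set \<Rightarrow> (real \<times> real) set \<Rightarrow> real \<Rightarrow> bool" where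
  "below_at A B x \<longleftrightarrow> (\<exists>y z. (x, y) \<in> A \<and> (x, z) \<in> B \<and> y < z)"

text \<open>
  Meant for x-monotone curves: at a proper crossing, both curves extend to both sides of the
  common point and their vertical order is reversed there. In particular, a common point that is
  an endpoint of one of the curves is not a proper crossing.
\<close>

definition properly_cross_at ::
    "(real \<times> real) set \<Rightarrow> (real \<times> real) set \<Rightarrow> real \<times> real \<Rightarrow> bool" where
  "properly_cross_at A B p \<longleftrightarrow> p \<in> A \<inter> B \<and>
     (\<exists>d>0. (\<forall>x\<in>{fst p - d<..<fst p}. below_at A B x) \<and>
             (\<forall>x\<in>{fst p<..<fst p + d}. below_at B A x) \<or>
            (\<forall>x\<in>{fst p - d<..<fst p}. below_at B A x) \<and>
             (\<forall>x\<in>{fst p<..<fst p + d}. below_at A B x))"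

definition touching_point ::
    "(real \<times> real) set \<Rightarrow> (real \<times> real) set \<Rightarrow> real \<times> real \<Rightarrow> bool" where
  "touching_point A B p \<longleftrightarrow> A \<inter> B = {p} \<and> \<not> properly_cross_at A B p"

definition touch :: "(real \<times> real) set \<Rightarrow> (real \<times> real) set \<Rightarrow> bool" where
  "touch A B \<longleftrightarrow> (\<exists>p. touching_point A B p)"

definition touching_pairs :: "(real \<times> real) set set \<Rightarrow> (real \<times> real) set set set" where
  "touching_pairs S = {{A, B} | A B. A \<in> S \<and> B \<in> S \<and> A \<noteq> B \<and> touch A B}"

definition crossing_points :: "(real \<times> real) set set \<Rightarrow> (real \<times> real) set" where
  "crossing_points S =
     {p. \<exists>A\<in>S. \<exists>B\<in>S. A \<noteq> B \<and> p \<in> A \<inter> B \<and> \<not> touching_point A B p}"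

end

theory Submission
  imports Defs "HOL-Real_Asymp.Real_Asymp"
begin

text \<open>
  Join an upper copy of a curve to a lower copy of another one if they touch with the first one
  above the second. If \<open>u\<close> and \<open>v\<close> both touch \<open>a\<close> from the same side, then \<open>u\<close> is closer to \<open>a\<close> than \<open>v\<close> at
  the first touching and \<open>v\<close> is closer at the second one, so \<open>u\<close> and \<open>v\<close> cross in between or one
  of them ends there; the latter costs only \<open>O(n\<^sup>2)\<close>, which the lower bound on \<open>\<epsilon>\<close> absorbs.

  Order the \<open>m\<close> touchings from left to right and cut this order into nested windows, each
  consisting of \<open>K\<close> windows of the next finer level, with \<open>K\<close> polylogarithmic, which gives
  \<open>J = \<Omega>(log n / log log n)\<close> levels. A pair of curves is joined in a window if it has a common
  neighbour there; it must then cross there. A pair joined in a window \<open>W\<close> is plain if it is joined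
  in a single child of \<open>W\<close> and all its crossings in \<open>W\<close> lie in that child. Pairs that are not plain
  cost crossings that other levels do not account for, so over all levels there are only \<open>O(X)\<close> of
  them, where \<open>X\<close> is the number of crossings. The main point is that if \<open>b\<close> touches \<open>u\<close> and \<open>v\<close> in
  one child, \<open>a\<close> touches \<open>u\<close> and \<open>v\<close> in \<open>W\<close>, and \<open>a\<close>, \<open>b\<close> are not joined in that child, then
  \<open>{u, v}\<close> and \<open>{a, b}\<close> are not both plain. Suitable weights \<open>f\<close>, \<open>g\<close> on these quadrilaterals, with
  total at most 1 on each pair \<open>{u, v}\<close> respectively \<open>{a, b}\<close>, satisfy \<open>\<Sum> sqrt (f g) = \<Omega>(m)\<close> on a
  positive proportion of the levels, and by Cauchy-Schwarz such a level has \<open>\<Omega>(m\<^sup>2 / X)\<close> pairs that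
  are not plain. Hence \<open>X\<^sup>2 = \<Omega>(J m\<^sup>2)\<close>.
\<close>

section \<open>Graphs with timed edges and pierced pairs\<close>

lemma sum_le_card_of_fibres:
  fixes f :: "'c \<Rightarrow> real"
  assumes "finite C" "finite B" "\<phi> ` C \<subseteq> B"
    and "\<And>b. b \<in> B \<Longrightarrow> (\<Sum>c | c \<in> C \<and> \<phi> c = b. f c) \<le> 1"
  shows "(\<Sum>c\<in>C. f c) \<le> card B"
proof -
  have "(\<Sum>c\<in>C. f c) = (\<Sum>b\<in>B. \<Sum>c | c \<in> C \<and> \<phi> c = b. f c)"
    using assms(1-3) by (rule sum.group[symmetric])
  also have "\<dots> \<le> (\<Sum>b\<in>B. 1)" by (intro sum_mono assms(4))
  finally show ?thesis by simp
qed

text \<open>Double counting: each fibre has at most \<open>N\<close> elements of weight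
  \<open>1 / N\<close>. The sums of degree ratios below are bounded in this way, the denominator
  being the size of a fibre.\<close>

lemma sum_le_card_of_small_fibres:
  fixes f :: "'c \<Rightarrow> real" and N :: "'b \<Rightarrow> nat"
  assumes "finite C" "finite B" "\<phi> ` C \<subseteq> B"
    and le: "\<And>b. b \<in> B \<Longrightarrow> card {c \<in> C. \<phi> c = b} \<le> N b"
    and eq: "\<And>c. c \<in> C \<Longrightarrow> f c = 1 / N (\<phi> c)"
  shows "(\<Sum>c\<in>C. f c) \<le> card B"
proof (rule sum_le_card_of_fibres[OF assms(1-3)])
  fix b assume b: "b \<in> B"
  have "(\<Sum>c | c \<in> C \<and> \<phi> c = b. f c) = (\<Sum>c | c \<in> C \<and> \<phi> c = b. 1 / N b)"
    by (rule sum.cong) (auto simp: eq)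
  also have "\<dots> = real (card {c \<in> C. \<phi> c = b}) / N b" by simp
  also have "\<dots> \<le> 1" using le[OF b] by (cases "N b = 0") (simp_all add: divide_le_eq_1)
  finally show "(\<Sum>c | c \<in> C \<and> \<phi> c = b. f c) \<le> 1" .
qed

lemma two_le_add_if_mult_eq_1:
  fixes x y :: real
  assumes "x * y = 1" "0 \<le> x" "0 \<le> y"
  shows "2 \<le> x + y"
proof (rule power2_le_imp_le)
  show "2\<^sup>2 \<le> (x + y)\<^sup>2" using sum_squares_bound[of x y] assms by (simp add: power2_sum)
qed (use assms in simp)

text \<open>The tangent of \<open>ln\<close> at \<open>c\<close>: it turns a bound on an average of
  ratios into a bound on the average of their logarithms.\<close>

lemma ln_le_ln_plus_div:
  fixes x c :: real
  assumes "0 < x" "0 < c"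
  shows "ln x \<le> ln c + x / c - 1"
  using ln_le_minus_one[of "x / c"] assms by (simp add: ln_div)

text \<open>Applied with \<open>x\<close>, \<open>x'\<close> the degrees of the two ends of an edge
  at one level and \<open>z\<close>, \<open>z'\<close> those at the next coarser level. If, say,
  \<open>z' <= H * x\<close>, then \<open>z * z' / (x * x')\<close> equals
  \<open>(z' / x)^2 * (x / x') * (z / z')\<close>, so the growth is controlled by \<open>H\<close>
  and by how unequal the two ends are at each level. A good edge is only granted the growth by a
  factor of about \<open>K\<close> at each end.\<close>

lemma ln_drop_le:
  fixes x x' z z' H l :: real and K :: nat
  assumes pos: "0 < x" "0 < x'" "0 < z" "0 < z'" and H: "1 \<le> H" and l: "1 \<le> l" and K: "0 < K"
    and "good \<longleftrightarrow> H * x \<le> z' \<and> H * x' \<le> z"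
  shows "ln z + ln z' - ln x - ln x' \<le> (if good then 2 * ln K else 0) + (z / x + z' / x') / K
    + (2 * ln H + 2 * ln l) + (x / x' + x' / x + z / z' + z' / z) / l"
proof (cases good)
  case True
  have "ln (z / x) \<le> ln K + (z / x) / K - 1" "ln (z' / x') \<le> ln K + (z' / x') / K - 1"
    using pos K by (intro ln_le_ln_plus_div; simp)+
  moreover have "0 \<le> 2 * ln H + 2 * ln l" using H l by simp
  moreover have "0 \<le> (x / x' + x' / x + z / z' + z' / z) / l" using pos l by simp
  ultimately show ?thesis using True pos by (simp add: ln_div add_divide_distrib)
next
  case False
  let ?R = "x / x' + x' / x" and ?S = "z / z' + z' / z"
  have R: "0 < ?R" "0 < ?S" using pos by (simp_all add: add_pos_pos)
  have "z * z' / (x * x') \<le> H\<^sup>2 * (?R * ?S)"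
  proof -
    consider "z' \<le> H * x" | "z \<le> H * x'" using False assms(8) by linarith
    then show ?thesis
    proof cases
      case 1
      then have "z'\<^sup>2 \<le> (H * x)\<^sup>2" using pos by (intro power_mono) auto
      then have "(z'\<^sup>2 / x\<^sup>2) * ((x / x') * (z / z')) \<le> H\<^sup>2 * ((x / x') * (z / z'))"
        using pos by (intro mult_right_mono) (simp_all add: power_mult_distrib divide_le_eq)
      also have "\<dots> \<le> H\<^sup>2 * (?R * ?S)"
        using pos by (intro mult_left_mono mult_mono) simp_all
      finally show ?thesis using pos by (simp add: power2_eq_square mult.commute)
    next
      case 2
      then have "z\<^sup>2 \<le> (H * x')\<^sup>2" using pos by (intro power_mono) auto
      then have "(z\<^sup>2 / x'\<^sup>2) * ((x' / x) * (z' / z)) \<le> H\<^sup>2 * ((x' / x) * (z' / z))"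
        using pos by (intro mult_right_mono) (simp_all add: power_mult_distrib divide_le_eq)
      also have "\<dots> \<le> H\<^sup>2 * (?R * ?S)"
        using pos by (intro mult_left_mono mult_mono) simp_all
      finally show ?thesis using pos by (simp add: power2_eq_square mult.commute)
    qed
  qed
  then have "ln (z * z' / (x * x')) \<le> ln (H\<^sup>2 * (?R * ?S))"
    using pos R H by (subst ln_le_cancel_iff) simp_all
  also have "\<dots> = 2 * ln H + (ln ?R + ln ?S)"
  proof -
    have "ln (H\<^sup>2 * (?R * ?S)) = ln (H\<^sup>2) + ln (?R * ?S)" using R H by (intro ln_mult_pos) auto
    also have "ln (?R * ?S) = ln ?R + ln ?S" using R by (intro ln_mult_pos) auto
    finally show ?thesis using H by (simp add: ln_realpow)
  qed
  also have "ln ?R \<le> ln l + ?R / l - 1" using R l by (intro ln_le_ln_plus_div) auto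
  also have "ln ?S \<le> ln l + ?S / l - 1" using R l by (intro ln_le_ln_plus_div) auto
  finally have "ln (z * z' / (x * x')) \<le> 2 * ln H + 2 * ln l + (?R / l + ?S / l)" by simp
  moreover have "ln (z * z' / (x * x')) = ln z + ln z' - ln x - ln x'"
    using pos by (simp add: ln_div ln_mult)
  moreover have "0 \<le> (z / x + z' / x') / K" using pos by simp
  ultimately show ?thesis using False by (simp add: add_divide_distrib)
qed

text \<open>
  \<open>E\<close> is a symmetric relation, so every edge occurs in both directions; \<open>\<tau> a u\<close> is the position of an
  edge in the left-to-right order, and \<open>P u v\<close> marks the positions where \<open>u\<close> and \<open>v\<close> cross.
\<close>

locale pierced_graph =
  fixes V :: "'v set" and E :: "('v \<times> 'v) set" and \<tau> :: "'v \<Rightarrow> 'v \<Rightarrow> nat"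
    and P :: "'v \<Rightarrow> 'v \<Rightarrow> nat set" and K s :: nat
  assumes finite_V: "finite V" and E_subset: "E \<subseteq> V \<times> V"
    and E_sym: "(a, u) \<in> E \<Longrightarrow> (u, a) \<in> E"
    and \<tau>_sym: "\<tau> a u = \<tau> u a"
    and \<tau>_inj: "(a, u) \<in> E \<Longrightarrow> (b, v) \<in> E \<Longrightarrow> \<tau> a u = \<tau> b v \<Longrightarrow> a = b \<and> u = v \<or> a = v \<and> u = b"
    and finite_P: "finite (P u v)" and P_sym: "P u v = P v u"
    and pierce: "(a, u) \<in> E \<Longrightarrow> (a, v) \<in> E \<Longrightarrow> u \<noteq> v \<Longrightarrow> \<tau> a u < \<tau> a v \<Longrightarrow>
      \<exists>p\<in>P u v. \<tau> a u < p \<and> p \<le> \<tau> a v"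
    and K_pos: "0 < K" and s_pos: "0 < s"
begin

section \<open>Windows, joined pairs and their piercings\<close>

definition win :: "nat \<Rightarrow> nat \<Rightarrow> nat" where
  "win j p = p div (s * K ^ j)"

definition nb :: "nat \<Rightarrow> 'v \<Rightarrow> nat \<Rightarrow> 'v set" where
  "nb j a i = {u. (a, u) \<in> E \<and> win j (\<tau> a u) = i}"

definition joined :: "nat \<Rightarrow> ('v \<times> 'v \<times> nat) set" where
  "joined j = {(u, v, i). u \<noteq> v \<and> (\<exists>a. u \<in> nb j a i \<and> v \<in> nb j a i)}"

definition pierces :: "('v \<times> 'v \<times> nat) set" where
  "pierces = {(u, v, p). u \<in> V \<and> v \<in> V \<and> p \<in> P u v}"

text \<open>
  The set \<open>forced j\<close> grows with \<open>j\<close>, so the gaps counted below are disjoint for different levels.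
\<close>

definition forced :: "nat \<Rightarrow> ('v \<times> 'v \<times> nat) set" where
  "forced j = {(u, v, p) \<in> pierces. (u, v, win j p) \<in> joined j}"

definition children :: "nat \<Rightarrow> 'v \<times> 'v \<times> nat \<Rightarrow> nat set" where
  "children j = (\<lambda>(u, v, i). {k. k div K = i \<and> (u, v, k) \<in> joined j})"

definition gaps :: "nat \<Rightarrow> 'v \<times> 'v \<times> nat \<Rightarrow> nat set" where
  "gaps j = (\<lambda>(u, v, i). {p \<in> P u v. win (Suc j) p = i \<and> (u, v, win j p) \<notin> joined j})"

definition gain :: "nat \<Rightarrow> ('v \<times> 'v \<times> nat) set" where
  "gain j = {t \<in> joined (Suc j). \<not> (card (children j t) = 1 \<and> gaps j t = {})}"

text \<open>Telescoping form of a sum of nonnegative charges over the pairs joined at level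
  \<open>Suc j\<close>, see \<open>\<Gamma>_eq\<close>. The factor 2 lets even a pair with no child
  and a single gap be charged 1.\<close>

definition \<Gamma> :: "nat \<Rightarrow> real" where
  "\<Gamma> j = real (card (joined j)) - real (card (joined (Suc j)))
     + 2 * (real (card (forced (Suc j))) - real (card (forced j)))"

lemma win_Suc: "win (Suc j) p = win j p div K"
  unfolding win_def by (metis div_mult2_eq mult.assoc power_Suc2)

lemma win_mono: "p \<le> q \<Longrightarrow> win j p \<le> win j q"
  unfolding win_def by (rule div_le_mono)

lemma win_less_imp: "win j p < win j q \<Longrightarrow> p < q"
  using win_mono by (meson leD not_le_imp_less)

lemma finite_E: "finite E"
  using finite_V E_subset finite_subset by blast

lemma nb_sym: "u \<in> nb j a i \<longleftrightarrow> a \<in> nb j u i"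
  unfolding nb_def using E_sym \<tau>_sym by auto

lemma nb_subset: "nb j a i \<subseteq> V"
  unfolding nb_def using E_subset by auto

lemma finite_nb: "finite (nb j a i)"
  by (rule finite_subset[OF nb_subset finite_V])

lemma nb_Suc: "u \<in> nb j a i \<Longrightarrow> u \<in> nb (Suc j) a (i div K)"
  unfolding nb_def by (auto simp: win_Suc)

lemma joined_Suc: "(u, v, i) \<in> joined j \<Longrightarrow> (u, v, i div K) \<in> joined (Suc j)"
  unfolding joined_def using nb_Suc by blast

lemma joinedI: "u \<noteq> v \<Longrightarrow> u \<in> nb j a i \<Longrightarrow> v \<in> nb j a i \<Longrightarrow> (u, v, i) \<in> joined j"
  unfolding joined_def by blast

lemma joined_sym: "(u, v, i) \<in> joined j \<Longrightarrow> (v, u, i) \<in> joined j"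
  unfolding joined_def by blast

lemma joined_subset: "joined j \<subseteq> V \<times> V \<times> (\<lambda>(a, u). win j (\<tau> a u)) ` E"
  unfolding joined_def nb_def using E_subset by force

lemma finite_joined: "finite (joined j)"
  by (rule finite_subset[OF joined_subset]) (simp add: finite_V finite_E)

lemma finite_pierces: "finite pierces"
proof -
  have "pierces = Sigma V (\<lambda>u. Sigma V (\<lambda>v. P u v))"
    unfolding pierces_def by auto
  then show ?thesis using finite_V finite_P by (simp add: finite_SigmaI)
qed

lemma finite_forced: "finite (forced j)"
  unfolding forced_def using finite_pierces by (rule rev_finite_subset) auto

lemma pierce_win:
  assumes "u \<in> nb j a i" "v \<in> nb j a i" "u \<noteq> v"
  obtains p where "p \<in> P u v" "win j p = i" "min (\<tau> a u) (\<tau> a v) < p" "p \<le> max (\<tau> a u) (\<tau> a v)"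
proof -
  have *: "\<exists>p\<in>P u v. win j p = i \<and> min (\<tau> a u) (\<tau> a v) < p \<and> p \<le> max (\<tau> a u) (\<tau> a v)"
    if "u \<in> nb j a i" "v \<in> nb j a i" "u \<noteq> v" "\<tau> a u < \<tau> a v" for u v
  proof -
    from that obtain p where p: "p \<in> P u v" "\<tau> a u < p" "p \<le> \<tau> a v"
      using pierce unfolding nb_def by blast
    then have "win j (\<tau> a u) \<le> win j p" "win j p \<le> win j (\<tau> a v)"
      by (simp_all add: win_mono)
    with that have "win j p = i" unfolding nb_def by auto
    with p that show ?thesis by auto
  qed
  have "\<tau> a u \<noteq> \<tau> a v"
    using assms \<tau>_inj[of a u a v] unfolding nb_def by auto
  then consider "\<tau> a u < \<tau> a v" | "\<tau> a v < \<tau> a u" by linarith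
  then show ?thesis
  proof cases
    case 1
    with *[of u v] assms that show ?thesis by blast
  next
    case 2
    with *[of v u] assms that show ?thesis
      by (metis P_sym min.commute max.commute)
  qed
qed

lemma joined_pierced:
  assumes "(u, v, i) \<in> joined j"
  shows "\<exists>p\<in>P u v. win j p = i"
  using assms pierce_win unfolding joined_def by blast

text \<open>Every joined pair is pierced in its window, and the windows of one level are
  disjoint.\<close>

lemma card_joined_le: "card (joined j) \<le> card pierces"
proof (rule surj_card_le[OF finite_pierces])
  show "joined j \<subseteq> (\<lambda>(u, v, p). (u, v, win j p)) ` pierces"
  proof
    fix t assume t: "t \<in> joined j"
    obtain u v i where [simp]: "t = (u, v, i)" by (cases t)
    from t obtain p where "p \<in> P u v" "win j p = i" using joined_pierced[of u v i j] by auto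
    moreover have "u \<in> V" "v \<in> V" using t joined_subset by auto
    ultimately show "t \<in> (\<lambda>(u, v, p). (u, v, win j p)) ` pierces"
      unfolding pierces_def by force
  qed
qed

lemma forced_mono: "forced j \<subseteq> forced (Suc j)"
  unfolding forced_def using joined_Suc by (auto simp: win_Suc)

lemma finite_children: "finite (children j t)"
proof -
  obtain u v i where [simp]: "t = (u, v, i)" by (cases t)
  have "children j t \<subseteq> (\<lambda>(u, v, i). i) ` joined j"
    unfolding children_def by force
  then show ?thesis using finite_joined finite_subset by blast
qed

lemma finite_gaps: "finite (gaps j t)"
  unfolding gaps_def using finite_P by (auto split: prod.split)

lemma sum_card_children:
  assumes "G \<subseteq> joined (Suc j)"
  shows "(\<Sum>t\<in>G. card (children j t)) = card {(u, v, k) \<in> joined j. (u, v, k div K) \<in> G}"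
proof -
  have fG: "finite G" using assms finite_joined finite_subset by blast
  have "(\<Sum>t\<in>G. card (children j t)) = card (Sigma G (children j))"
    using fG finite_children by (simp add: card_SigmaI)
  also have "\<dots> = card {(u, v, k) \<in> joined j. (u, v, k div K) \<in> G}"
    by (rule bij_betw_same_card[of "\<lambda>((u, v, i), k). (u, v, k)"])
      (auto simp: bij_betw_def inj_on_def children_def image_iff, force)
  finally show ?thesis .
qed

lemma sum_card_children_joined: "(\<Sum>t\<in>joined (Suc j). card (children j t)) = card (joined j)"
  by (subst sum_card_children) (auto intro!: arg_cong[where f=card] joined_Suc)

text \<open>A piercing enters \<open>forced (Suc j)\<close> anew exactly if the pair is joined in
  its parent window but not in its child window, that is, if it is a gap.\<close>

lemma sum_card_gaps: "(\<Sum>t\<in>joined (Suc j). card (gaps j t)) = card (forced (Suc j)) - card (forced j)"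
proof -
  have "(\<Sum>t\<in>joined (Suc j). card (gaps j t)) = card (Sigma (joined (Suc j)) (gaps j))"
    using finite_joined finite_gaps by (simp add: card_SigmaI)
  also have "\<dots> = card (forced (Suc j) - forced j)"
  proof (rule bij_betw_same_card[of "\<lambda>((u, v, i), p). (u, v, p)"], unfold bij_betw_def, safe)
    show "inj_on (\<lambda>((u, v, i), p). (u, v, p)) (Sigma (joined (Suc j)) (gaps j))"
      by (auto simp: inj_on_def gaps_def)
  next
    fix u v i p assume "(u, v, i) \<in> joined (Suc j)" "p \<in> gaps j (u, v, i)"
    then show "(u, v, p) \<in> forced (Suc j)"
      unfolding forced_def pierces_def gaps_def using joined_subset by auto
  next
    fix u v i p assume "(u, v, i) \<in> joined (Suc j)" "p \<in> gaps j (u, v, i)" "(u, v, p) \<in> forced j"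
    then show False unfolding forced_def gaps_def by auto
  next
    fix u v p assume "(u, v, p) \<in> forced (Suc j)" "(u, v, p) \<notin> forced j"
    then have "((u, v, win (Suc j) p), p) \<in> Sigma (joined (Suc j)) (gaps j)"
      unfolding forced_def gaps_def pierces_def by auto
    then show "(u, v, p) \<in> (\<lambda>((u, v, i), p). (u, v, p)) ` Sigma (joined (Suc j)) (gaps j)"
      by force
  qed
  also have "\<dots> = card (forced (Suc j)) - card (forced j)"
    using card_Diff_subset[OF finite_forced forced_mono] .
  finally show ?thesis .
qed

text \<open>The piercing in the window of a joined pair lies in a joined child or else is a gap.
  This keeps all charges in \<open>\<Gamma>_eq\<close> nonnegative.\<close>

lemma children_or_gaps:
  assumes "t \<in> joined (Suc j)"
  shows "1 \<le> card (children j t) + card (gaps j t)"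
proof -
  obtain u v i where t: "t = (u, v, i)" by (cases t)
  obtain p where p: "p \<in> P u v" "win (Suc j) p = i" using joined_pierced assms t by blast
  then have "win j p \<in> children j t \<or> p \<in> gaps j t"
    unfolding children_def gaps_def t by (auto simp: win_Suc)
  then have "children j t \<noteq> {} \<or> gaps j t \<noteq> {}" by auto
  then have "card (children j t) \<noteq> 0 \<or> card (gaps j t) \<noteq> 0"
    using finite_children finite_gaps by auto
  then show ?thesis by linarith
qed

lemma \<Gamma>_eq:
  "\<Gamma> j = (\<Sum>t\<in>joined (Suc j). real (card (children j t)) + 2 * real (card (gaps j t)) - 1)"
proof -
  have "real (\<Sum>t\<in>joined (Suc j). card (gaps j t)) = real (card (forced (Suc j))) - real (card (forced j))"
    unfolding sum_card_gaps using card_mono[OF finite_forced forced_mono] by (simp add: of_nat_diff)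
  then show ?thesis
    unfolding \<Gamma>_def using sum_card_children_joined[of j, symmetric]
    by (simp add: sum.distrib sum_subtractf flip: sum_distrib_left)
qed

lemma \<Gamma>_ge_sum_gain:
  "(\<Sum>t\<in>gain j. real (card (children j t)) + 2 * real (card (gaps j t)) - 1) \<le> \<Gamma> j"
  unfolding \<Gamma>_eq
proof (rule sum_mono2[OF finite_joined])
  show "gain j \<subseteq> joined (Suc j)" unfolding gain_def by auto
  fix t assume "t \<in> joined (Suc j) - gain j"
  then show "0 \<le> real (card (children j t)) + 2 * real (card (gaps j t)) - 1"
    using children_or_gaps[of t j] by auto
qed

lemma finite_gain: "finite (gain j)"
  unfolding gain_def using finite_joined by auto

text \<open>One child and no gap is the only case of charge 0. The second bound lets the charge pay
  for all children of a pair with a gain, not only for the pair itself.\<close>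

lemma gain_cases:
  assumes "t \<in> gain j"
  shows "1 \<le> real (card (children j t)) + 2 * real (card (gaps j t)) - 1"
    and "real (card (children j t)) \<le> 2 * (real (card (children j t)) + 2 * real (card (gaps j t)) - 1)"
proof -
  have "\<not> (card (children j t) = 1 \<and> card (gaps j t) = 0)"
    using assms finite_gaps unfolding gain_def by auto
  moreover have "1 \<le> card (children j t) + card (gaps j t)"
    using assms children_or_gaps unfolding gain_def by auto
  ultimately have "2 \<le> card (children j t) + 2 * card (gaps j t)"
    by linarith
  then have "2 \<le> real (card (children j t)) + 2 * real (card (gaps j t))" by linarith
  then show "1 \<le> real (card (children j t)) + 2 * real (card (gaps j t)) - 1"
    "real (card (children j t)) \<le> 2 * (real (card (children j t)) + 2 * real (card (gaps j t)) - 1)"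
    by auto
qed

lemma card_gain_le: "real (card (gain j)) \<le> \<Gamma> j"
proof -
  have "real (card (gain j)) = (\<Sum>t\<in>gain j. 1)" by simp
  also have "\<dots> \<le> (\<Sum>t\<in>gain j. real (card (children j t)) + 2 * real (card (gaps j t)) - 1)"
    by (intro sum_mono gain_cases)
  finally show ?thesis using \<Gamma>_ge_sum_gain[of j] by linarith
qed

text \<open>The outer weights live on child windows, so the joined children of pairs with a gain
  have to be counted as well.\<close>

lemma card_children_gain_le:
  "real (card {(u, v, k) \<in> joined j. (u, v, k div K) \<in> gain j}) \<le> 2 * \<Gamma> j"
proof -
  have "real (card {(u, v, k) \<in> joined j. (u, v, k div K) \<in> gain j}) = (\<Sum>t\<in>gain j. real (card (children j t)))"
    by (subst sum_card_children[symmetric]) (auto simp: gain_def)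
  also have "\<dots> \<le> (\<Sum>t\<in>gain j. 2 * (real (card (children j t)) + 2 * real (card (gaps j t)) - 1))"
    by (intro sum_mono gain_cases)
  also have "\<dots> = 2 * (\<Sum>t\<in>gain j. real (card (children j t)) + 2 * real (card (gaps j t)) - 1)"
    by (rule sum_distrib_left[symmetric])
  finally show ?thesis using \<Gamma>_ge_sum_gain[of j] by linarith
qed

text \<open>The sum telescopes; \<open>joined 0\<close> and twice \<open>forced J\<close> remain
  with a positive sign, and each set has at most as many elements as \<open>pierces\<close>.\<close>

lemma sum_\<Gamma>_le: "(\<Sum>j<J. \<Gamma> j) \<le> 3 * real (card pierces)"
proof -
  have "(\<Sum>j<J. \<Gamma> j) = real (card (joined 0)) - real (card (joined J))
      + 2 * (real (card (forced J)) - real (card (forced 0)))"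
    by (induction J) (auto simp: \<Gamma>_def)
  moreover have "real (card (joined 0)) \<le> real (card pierces)" by (simp add: card_joined_le)
  moreover have "real (card (forced J)) \<le> real (card pierces)"
    unfolding of_nat_le_iff by (intro card_mono finite_pierces) (auto simp: forced_def)
  moreover have "0 \<le> real (card (joined J))" "0 \<le> real (card (forced 0))" by simp_all
  ultimately show ?thesis by argo
qed

lemma not_gain:
  assumes "(u, v, i) \<in> joined (Suc j)" "(u, v, i) \<notin> gain j"
  shows "\<exists>k. (u, v, k) \<in> joined j \<and> (\<forall>k'. (u, v, k') \<in> joined j \<longrightarrow> k' div K = i \<longrightarrow> k' = k) \<and>
    (\<forall>p\<in>P u v. win (Suc j) p = i \<longrightarrow> win j p = k)"
proof -
  have "card (children j (u, v, i)) = 1" and g: "gaps j (u, v, i) = {}"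
    using assms unfolding gain_def by auto
  then obtain k where k: "children j (u, v, i) = {k}" using card_1_singletonE by blast
  then have "(u, v, k) \<in> joined j" and u: "\<And>k'. (u, v, k') \<in> joined j \<Longrightarrow> k' div K = i \<Longrightarrow> k' = k"
    unfolding children_def by auto
  moreover have "win j p = k" if "p \<in> P u v" "win (Suc j) p = i" for p
    using g that u[of "win j p"] unfolding gaps_def by (auto simp: win_Suc)
  ultimately show ?thesis by blast
qed

text \<open>
  If \<open>{u, v}\<close> has no gain, then \<open>a\<close> touches \<open>u\<close> and \<open>v\<close> on different sides of window \<open>k\<close>. Hence \<open>a\<close> and
  \<open>a'\<close> cross once not after and once not before window \<open>k\<close>, and without a gain both crossings would
  lie in the one child in which \<open>a\<close> and \<open>a'\<close> are joined, which is not \<open>k\<close>.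
\<close>

lemma gain_of_quadrilateral:
  assumes "u \<in> nb j a' k" "v \<in> nb j a' k" "u \<noteq> v"
    and "u \<in> nb (Suc j) a (k div K)" "v \<in> nb (Suc j) a (k div K)" "a \<noteq> a'"
    and nj: "(a, a', k) \<notin> joined j"
  shows "(u, v, k div K) \<in> gain j \<or> (a, a', k div K) \<in> gain j"
proof (rule ccontr)
  let ?i = "k div K"
  have main: False
    if uv: "u \<in> nb j a' k" "v \<in> nb j a' k" "u \<noteq> v" "\<tau> a u \<le> \<tau> a v"
      and auv: "u \<in> nb (Suc j) a ?i" "v \<in> nb (Suc j) a ?i"
      and ng: "(u, v, ?i) \<notin> gain j" "(a, a', ?i) \<notin> gain j" for u v
  proof -
    have a': "u \<in> nb (Suc j) a' ?i" "v \<in> nb (Suc j) a' ?i" using uv nb_Suc by auto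
    have "(u, v, ?i) \<in> joined (Suc j)" using auv uv(3) joinedI by blast
    from not_gain[OF this ng(1)] obtain k1 where k1: "(u, v, k1) \<in> joined j"
      "\<forall>k'. (u, v, k') \<in> joined j \<longrightarrow> k' div K = ?i \<longrightarrow> k' = k1"
      "\<forall>p\<in>P u v. win (Suc j) p = ?i \<longrightarrow> win j p = k1"
      by (elim exE conjE) (rule that)
    have "k1 = k" using k1(2) uv(1-3) joinedI[of u v j a' k] by simp
    have "(a, a', ?i) \<in> joined (Suc j)"
      using auv(1) a'(1) assms(6) joinedI[of a a' "Suc j" u ?i] nb_sym[of u "Suc j"] by blast
    from not_gain[OF this ng(2)] obtain k0 where k0: "(a, a', k0) \<in> joined j"
      "\<forall>p\<in>P a a'. win (Suc j) p = ?i \<longrightarrow> win j p = k0"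
      by (elim exE conjE) (rule that)
    have "u \<notin> nb j a k" "v \<notin> nb j a k"
      using nj uv(1,2) assms(6) joinedI[of a a' j u k] joinedI[of a a' j v k]
        nb_sym[of u j] nb_sym[of v j] by blast+
    then have ne: "win j (\<tau> a u) \<noteq> k" "win j (\<tau> a v) \<noteq> k"
      using auv unfolding nb_def by auto
    obtain p where p: "p \<in> P u v" "win (Suc j) p = ?i" "min (\<tau> a u) (\<tau> a v) < p" "p \<le> max (\<tau> a u) (\<tau> a v)"
      using pierce_win[OF auv uv(3)] by blast
    have "win j p = k" using k1(3) p(1,2) \<open>k1 = k\<close> by auto
    moreover have "win j (\<tau> a u) \<le> win j p" "win j p \<le> win j (\<tau> a v)"
      using p(3,4) uv(4) by (auto intro!: win_mono)
    ultimately have lt: "win j (\<tau> a u) < k" "k < win j (\<tau> a v)" using ne by auto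
    have wk: "win j (\<tau> a' u) = k" "win j (\<tau> a' v) = k" using uv unfolding nb_def by auto
    have ord: "\<tau> a u < \<tau> a' u" "\<tau> a' v < \<tau> a v"
      using lt wk win_less_imp[of j "\<tau> a u" "\<tau> a' u"] win_less_imp[of j "\<tau> a' v" "\<tau> a v"] by simp_all
    obtain p1 where p1: "p1 \<in> P a a'" "win (Suc j) p1 = ?i" "p1 \<le> max (\<tau> u a) (\<tau> u a')"
      using pierce_win[of a "Suc j" u ?i a'] auv(1) a'(1) nb_sym[of u "Suc j"] assms(6) by blast
    obtain p2 where p2: "p2 \<in> P a a'" "win (Suc j) p2 = ?i" "min (\<tau> v a) (\<tau> v a') < p2"
      using pierce_win[of a "Suc j" v ?i a'] auv(2) a'(2) nb_sym[of v "Suc j"] assms(6) by blast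
    have "p1 \<le> \<tau> a' u" "\<tau> a' v \<le> p2"
      using p1(3) p2(3) ord by (auto simp: \<tau>_sym[of u] \<tau>_sym[of v])
    then have "win j p1 \<le> k" "k \<le> win j p2" using wk win_mono by metis+
    then have "k0 = k" using k0(2) p1(1,2) p2(1,2) by (metis le_antisym)
    then show False using k0(1) nj by simp
  qed
  assume "\<not> ?thesis"
  moreover have "(v, u, ?i) \<in> gain j \<Longrightarrow> (u, v, ?i) \<in> gain j"
  proof -
    have "children j (v, u, ?i) = children j (u, v, ?i)" "gaps j (v, u, ?i) = gaps j (u, v, ?i)"
      unfolding children_def gaps_def using joined_sym P_sym by auto
    then show "(v, u, ?i) \<in> gain j \<Longrightarrow> (u, v, ?i) \<in> gain j"
      unfolding gain_def using joined_sym by auto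
  qed
  ultimately show False
    using main[of u v] main[of v u] assms by (metis nle_le)
qed

subsection \<open>Weighted quadrilaterals\<close>

definition deg :: "nat \<Rightarrow> 'v \<Rightarrow> nat \<Rightarrow> nat" where
  "deg j a i = card (nb j a i)"

lemma parent_window: "{k. k div K = i} = {i * K..<i * K + K}"
proof safe
  fix k
  have k: "k = k div K * K + k mod K" by simp
  show "k \<in> {k div K * K..<k div K * K + K}"
    using k mod_less_divisor[OF K_pos, of k] unfolding atLeastLessThan_iff by linarith
next
  fix k assume "k \<in> {i * K..<i * K + K}"
  then show "k div K = i" by (intro div_nat_eqI) (auto simp: mult.commute)
qed

lemma deg_Suc: "deg (Suc j) a i = (\<Sum>k | k div K = i. deg j a k)"
proof -
  have "nb (Suc j) a i = (\<Union>k\<in>{k. k div K = i}. nb j a k)"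
    unfolding nb_def by (auto simp: win_Suc)
  also have "card \<dots> = (\<Sum>k | k div K = i. card (nb j a k))"
    by (rule card_UN_disjoint) (auto simp: finite_nb parent_window, auto simp: nb_def)
  finally show ?thesis unfolding deg_def .
qed

text \<open>The two levels are those of \<open>gain_of_quadrilateral\<close>: \<open>a\<close> is
  seen in the parent window, \<open>b\<close> in the child window \<open>k\<close>.\<close>

definition common :: "nat \<Rightarrow> 'v \<Rightarrow> 'v \<Rightarrow> nat \<Rightarrow> 'v set" where
  "common j a b k = nb (Suc j) a (k div K) \<inter> nb j b k"

definition quads :: "nat \<Rightarrow> (('v \<times> 'v) \<times> 'v \<times> 'v) set" where
  "quads j = Sigma E (\<lambda>(b, u). Sigma (nb (Suc j) u (win (Suc j) (\<tau> b u)))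
     (\<lambda>a. {v \<in> common j a b (win j (\<tau> b u)). v \<noteq> u \<and> a \<noteq> b \<and> (a, b, win j (\<tau> b u)) \<notin> joined j}))"

text \<open>
  The outer weights sum to at most 1 over all quadrilaterals with given \<open>u\<close>, \<open>v\<close> and given child window,
  the inner weights over all those with given \<open>a\<close>, \<open>b\<close> and given parent window. The geometric mean of
  both, summed over \<open>a\<close> and \<open>v\<close>, depends on the edge \<open>(b, u)\<close> only through a ratio of degrees which
  is inverted when the edge is reversed.
\<close>

definition outer_weight :: "nat \<Rightarrow> ('v \<times> 'v) \<times> 'v \<times> 'v \<Rightarrow> real" where
  "outer_weight j = (\<lambda>((b, u), a, v). 1 / (deg j u (win j (\<tau> b u)) * deg (Suc j) u (win (Suc j) (\<tau> b u))))"

definition inner_weight :: "nat \<Rightarrow> ('v \<times> 'v) \<times> 'v \<times> 'v \<Rightarrow> real" where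
  "inner_weight j = (\<lambda>((b, u), a, v). deg j b (win j (\<tau> b u)) /
     (deg (Suc j) b (win (Suc j) (\<tau> b u)) * (card (common j a b (win j (\<tau> b u))))\<^sup>2))"

lemma finite_quads: "finite (quads j)"
  unfolding quads_def using finite_E finite_nb by (auto simp: common_def intro!: finite_SigmaI)

lemma quadsD:
  assumes "((b, u), a, v) \<in> quads j"
  defines "k \<equiv> win j (\<tau> b u)"
  shows "win (Suc j) (\<tau> b u) = k div K" "u \<in> nb j b k" "v \<in> nb j b k" "u \<noteq> v"
    "u \<in> nb (Suc j) a (k div K)" "v \<in> nb (Suc j) a (k div K)" "a \<noteq> b" "(a, b, k) \<notin> joined j"
    "b \<in> nb j u k" "a \<in> nb (Suc j) u (k div K)"
proof -
  show "win (Suc j) (\<tau> b u) = k div K" by (simp add: win_Suc k_def)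
  show "u \<in> nb j b k" "v \<in> nb j b k" "u \<noteq> v" "v \<in> nb (Suc j) a (k div K)" "a \<noteq> b" "(a, b, k) \<notin> joined j"
    "a \<in> nb (Suc j) u (k div K)"
    using assms(1) unfolding quads_def common_def k_def by (auto simp: nb_def win_Suc)
  then show "u \<in> nb (Suc j) a (k div K)" "b \<in> nb j u k"
    using nb_sym[of u "Suc j"] nb_sym[of u j] by auto
qed

text \<open>For fixed \<open>u\<close>, \<open>v\<close>, \<open>k\<close> the weight is the
  reciprocal of the number of candidates for \<open>b\<close> and \<open>a\<close>. The target
  \<open>B\<close> is left open, to be either all joined pairs or only those below a gain.\<close>

lemma sum_outer_weight_le:
  assumes C: "C \<subseteq> quads j" and B: "finite B"
    and sub: "(\<lambda>((b, u), a, v). (u, v, win j (\<tau> b u))) ` C \<subseteq> B"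
  shows "(\<Sum>c\<in>C. outer_weight j c) \<le> card B"
proof (rule sum_le_card_of_fibres[OF finite_subset[OF C finite_quads] B sub])
  fix t assume "t \<in> B"
  obtain u v k where t: "t = (u, v, k)" by (cases t)
  let ?F = "{c \<in> C. (\<lambda>((b, u), a, v). (u, v, win j (\<tau> b u))) c = t}"
  let ?N = "nb j u k \<times> nb (Suc j) u (k div K)"
  let ?w = "1 / (deg j u k * deg (Suc j) u (k div K))"
  have sub: "?F \<subseteq> (\<lambda>(b, a). ((b, u), a, v)) ` ?N"
  proof
    fix c assume c: "c \<in> ?F"
    obtain b u' a v' where [simp]: "c = ((b, u'), a, v')" by (metis prod.exhaust)
    have [simp]: "u' = u" "v' = v" and k: "win j (\<tau> b u) = k" using c t by auto
    have "((b, u), a, v) \<in> quads j" using c C by auto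
    from quadsD(9,10)[OF this] k have "(b, a) \<in> ?N" by auto
    then show "c \<in> (\<lambda>(b, a). ((b, u), a, v)) ` ?N" by force
  qed
  have "card ?F \<le> card ?N"
    using card_mono[OF _ sub] card_image_le[of ?N "\<lambda>(b, a). ((b, u), a, v)"] finite_nb
    by (meson finite_SigmaI finite_imageI le_trans)
  also have "\<dots> = deg j u k * deg (Suc j) u (k div K)"
    by (simp add: deg_def card_cartesian_product)
  finally have card: "card ?F \<le> deg j u k * deg (Suc j) u (k div K)" .
  have "(\<Sum>c\<in>?F. outer_weight j c) = (\<Sum>c\<in>?F. ?w)"
    using t by (intro sum.cong refl) (auto simp: outer_weight_def win_Suc)
  also have "\<dots> = real (card ?F) * ?w" by simp
  also have "\<dots> \<le> real (deg j u k * deg (Suc j) u (k div K)) * ?w"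
    using card by (intro mult_right_mono) (simp_all only: of_nat_le_iff, simp)
  also have "\<dots> \<le> 1" by (simp add: divide_le_eq_1)
  finally show "(\<Sum>c | c \<in> C \<and> (\<lambda>((b, u), a, v). (u, v, win j (\<tau> b u))) c = t. outer_weight j c) \<le> 1" .
qed

text \<open>Within one child \<open>k\<close> both \<open>u\<close> and \<open>v\<close> come from
  \<open>common j a b k\<close>, so the squared size cancels and
  \<open>deg j b k / deg (Suc j) b i\<close> remains. Over the children these ratios add up to at
  most 1.\<close>

lemma sum_inner_weight_le:
  assumes C: "C \<subseteq> quads j" and B: "finite B"
    and sub: "(\<lambda>((b, u), a, v). (a, b, win (Suc j) (\<tau> b u))) ` C \<subseteq> B"
  shows "(\<Sum>c\<in>C. inner_weight j c) \<le> card B"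
proof (rule sum_le_card_of_fibres[OF finite_subset[OF C finite_quads] B sub])
  fix t assume "t \<in> B"
  obtain a b i where t: "t = (a, b, i)" by (cases t)
  let ?F = "{c \<in> C. (\<lambda>((b, u), a, v). (a, b, win (Suc j) (\<tau> b u))) c = t}"
  let ?k = "\<lambda>((b, u), a, v). win j (\<tau> b u)"
  have finF: "finite ?F" using finite_subset[OF C finite_quads] by auto
  have part: "(\<Sum>c | c \<in> ?F \<and> ?k c = k. inner_weight j c) \<le> deg j b k / deg (Suc j) b i"
    if "k div K = i" for k
  proof -
    let ?G = "{c \<in> ?F. ?k c = k}"
    let ?Q = "common j a b k"
    let ?w = "deg j b k / (deg (Suc j) b i * (card ?Q)\<^sup>2)"
    have finQ: "finite ?Q" unfolding common_def using finite_nb by auto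
    have sub: "?G \<subseteq> (\<lambda>(u, v). ((b, u), a, v)) ` (?Q \<times> ?Q)"
    proof
      fix c assume c: "c \<in> ?G"
      obtain b' u a' v where [simp]: "c = ((b', u), a', v)" by (metis prod.exhaust)
      have [simp]: "b' = b" "a' = a" and k: "win j (\<tau> b u) = k" using c t by auto
      have "((b, u), a, v) \<in> quads j" using c C by auto
      from quadsD(2,3,5,6)[OF this] k have "(u, v) \<in> ?Q \<times> ?Q" by (auto simp: common_def)
      then show "c \<in> (\<lambda>(u, v). ((b, u), a, v)) ` (?Q \<times> ?Q)" by force
    qed
    have "card ?G \<le> card (?Q \<times> ?Q)"
      using card_mono[OF _ sub] card_image_le[of "?Q \<times> ?Q" "\<lambda>(u, v). ((b, u), a, v)"] finQ
      by (meson finite_SigmaI finite_imageI le_trans)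
    also have "\<dots> = (card ?Q)\<^sup>2"
      by (simp add: card_cartesian_product power2_eq_square)
    finally have card: "card ?G \<le> (card ?Q)\<^sup>2" .
    have "(\<Sum>c\<in>?G. inner_weight j c) = (\<Sum>c\<in>?G. ?w)"
      using t by (intro sum.cong refl) (auto simp: inner_weight_def)
    also have "\<dots> = real (card ?G) * ?w" by simp
    also have "\<dots> \<le> real ((card ?Q)\<^sup>2) * ?w"
      using card by (intro mult_right_mono) (simp_all only: of_nat_le_iff, simp)
    also have "\<dots> \<le> deg j b k / deg (Suc j) b i" by (simp add: field_simps)
    finally show ?thesis by simp
  qed
  have "(\<Sum>c\<in>?F. inner_weight j c) = (\<Sum>k | k div K = i. \<Sum>c | c \<in> ?F \<and> ?k c = k. inner_weight j c)"
  proof (rule sum.group[symmetric, OF finF])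
    show "finite {k. k div K = i}" by (simp add: parent_window)
    show "?k ` ?F \<subseteq> {k. k div K = i}" using t by (auto simp: win_Suc)
  qed
  also have "\<dots> \<le> (\<Sum>k | k div K = i. deg j b k / deg (Suc j) b i)"
    by (intro sum_mono part) simp
  also have "\<dots> = (\<Sum>k | k div K = i. real (deg j b k)) / deg (Suc j) b i"
    by (rule sum_divide_distrib[symmetric])
  also have "\<dots> \<le> 1" unfolding deg_Suc of_nat_sum by (simp add: divide_le_eq_1)
  finally show "(\<Sum>c | c \<in> C \<and> (\<lambda>((b, u), a, v). (a, b, win (Suc j) (\<tau> b u))) c = t. inner_weight j c) \<le> 1" .
qed

lemma outer_weight_nonneg: "0 \<le> outer_weight j c"
  unfolding outer_weight_def by (auto split: prod.split)

lemma inner_weight_nonneg: "0 \<le> inner_weight j c"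
  unfolding inner_weight_def by (auto split: prod.split)

lemma \<Gamma>_nonneg: "0 \<le> \<Gamma> j"
  using card_gain_le[of j] by linarith

lemma sum_sqrt_weights_le:
  "(\<Sum>c\<in>quads j. sqrt (outer_weight j c) * sqrt (inner_weight j c))\<^sup>2 \<le> 6 * \<Gamma> j * card pierces"
proof -
  let ?X = "real (card pierces)"
  let ?S = "\<lambda>C. (\<Sum>c\<in>C. sqrt (outer_weight j c) * sqrt (inner_weight j c))"
  \<comment> \<open>By \<open>gain_of_quadrilateral\<close>, a quadrilateral outside
    \<open>C1\<close> has a gain at \<open>{a, b}\<close>. So on each part one of the two weight
    sums is bounded by a multiple of \<open>\<Gamma> j\<close>, the other by the number of
    piercings.\<close>
  define C1 where "C1 = {c \<in> quads j. (\<lambda>((b, u), a, v). (u, v, win (Suc j) (\<tau> b u))) c \<in> gain j}"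
  define C2 where "C2 = quads j - C1"
  have C: "C1 \<subseteq> quads j" "C2 \<subseteq> quads j" "finite C1" "finite C2" "C1 \<inter> C2 = {}" "quads j = C1 \<union> C2"
    unfolding C1_def C2_def using finite_quads by auto
  have CS: "(?S D)\<^sup>2 \<le> (\<Sum>c\<in>D. outer_weight j c) * (\<Sum>c\<in>D. inner_weight j c)" for D
    using Cauchy_Schwarz_ineq_sum[of "\<lambda>c. sqrt (outer_weight j c)" "\<lambda>c. sqrt (inner_weight j c)" D]
    by (simp add: outer_weight_nonneg inner_weight_nonneg)
  have outer: "(\<Sum>c\<in>D. outer_weight j c) \<le> ?X" if "D \<subseteq> quads j" for D
  proof -
    have "(\<Sum>c\<in>D. outer_weight j c) \<le> card (joined j)"
    proof (rule sum_outer_weight_le[OF that finite_joined], safe)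
      fix b u a v assume "((b, u), a, v) \<in> D"
      then have "((b, u), a, v) \<in> quads j" using that by auto
      from quadsD(2-4)[OF this] show "(u, v, win j (\<tau> b u)) \<in> joined j" by (intro joinedI)
    qed
    then show ?thesis using card_joined_le[of j] by linarith
  qed
  have inner: "(\<Sum>c\<in>D. inner_weight j c) \<le> ?X" if "D \<subseteq> quads j" for D
  proof -
    have "(\<Sum>c\<in>D. inner_weight j c) \<le> card (joined (Suc j))"
    proof (rule sum_inner_weight_le[OF that finite_joined], safe)
      fix b u a v assume "((b, u), a, v) \<in> D"
      then have "((b, u), a, v) \<in> quads j" using that by auto
      then show "(a, b, win (Suc j) (\<tau> b u)) \<in> joined (Suc j)"
        using joinedI[OF quadsD(7) quadsD(10) nb_Suc[OF quadsD(9)]] by (simp add: win_Suc)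
    qed
    then show ?thesis using card_joined_le[of "Suc j"] by linarith
  qed
  have "(\<Sum>c\<in>C1. outer_weight j c) \<le> card {(u, v, k) \<in> joined j. (u, v, k div K) \<in> gain j}"
  proof (rule sum_outer_weight_le[OF C(1)], safe)
    show "finite {(u, v, k) \<in> joined j. (u, v, k div K) \<in> gain j}"
      by (rule finite_subset[OF _ finite_joined[of j]]) auto
    fix b u a v assume c: "((b, u), a, v) \<in> C1"
    then have "((b, u), a, v) \<in> quads j" using C by auto
    from quadsD(2-4)[OF this] show "(u, v, win j (\<tau> b u)) \<in> joined j" by (intro joinedI)
    from c show "(u, v, win j (\<tau> b u) div K) \<in> gain j" unfolding C1_def by (simp add: win_Suc)
  qed
  then have o1: "(\<Sum>c\<in>C1. outer_weight j c) \<le> 2 * \<Gamma> j"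
    using card_children_gain_le[of j] by linarith
  have "(\<Sum>c\<in>C2. inner_weight j c) \<le> card (gain j)"
  proof (rule sum_inner_weight_le[OF C(2) finite_gain], safe)
    fix b u a v assume c: "((b, u), a, v) \<in> C2"
    then have q: "((b, u), a, v) \<in> quads j" using C by auto
    have "(u, v, win j (\<tau> b u) div K) \<notin> gain j"
      using c unfolding C2_def C1_def by (auto simp: win_Suc)
    then show "(a, b, win (Suc j) (\<tau> b u)) \<in> gain j"
      using gain_of_quadrilateral[OF quadsD(2-8)[OF q]] by (simp add: win_Suc)
  qed
  then have i2: "(\<Sum>c\<in>C2. inner_weight j c) \<le> \<Gamma> j"
    using card_gain_le[of j] by linarith
  have "(?S C1)\<^sup>2 \<le> 2 * \<Gamma> j * ?X"
  proof -
    have "(?S C1)\<^sup>2 \<le> (\<Sum>c\<in>C1. outer_weight j c) * (\<Sum>c\<in>C1. inner_weight j c)" by (rule CS)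
    also have "\<dots> \<le> 2 * \<Gamma> j * ?X"
      by (intro mult_mono o1 inner C sum_nonneg inner_weight_nonneg) (simp add: \<Gamma>_nonneg)
    finally show ?thesis .
  qed
  moreover have "(?S C2)\<^sup>2 \<le> ?X * \<Gamma> j"
  proof -
    have "(?S C2)\<^sup>2 \<le> (\<Sum>c\<in>C2. outer_weight j c) * (\<Sum>c\<in>C2. inner_weight j c)" by (rule CS)
    also have "\<dots> \<le> ?X * \<Gamma> j"
      by (intro mult_mono i2 outer C sum_nonneg inner_weight_nonneg) simp
    finally show ?thesis .
  qed
  moreover have "?S (quads j) = ?S C1 + ?S C2"
    unfolding C(6) using C(3-5) by (rule sum.union_disjoint)
  moreover have "(?S C1 + ?S C2)\<^sup>2 \<le> 2 * ((?S C1)\<^sup>2 + (?S C2)\<^sup>2)"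
    using sum_squares_bound[of "?S C1" "?S C2"] by (simp add: power2_sum)
  ultimately show ?thesis by (simp add: algebra_simps)
qed

text \<open>The first vertex is the end whose degree is taken; \<open>\<alpha> j u b\<close> belongs
  to the other end of the same edge.\<close>

definition \<alpha> :: "nat \<Rightarrow> 'v \<Rightarrow> 'v \<Rightarrow> real" where
  "\<alpha> j b u = real (deg j b (win j (\<tau> b u)))"

text \<open>Those \<open>a\<close> for which no \<open>v\<close> completes \<open>(b, u)\<close> and
  \<open>a\<close> to a quadrilateral.\<close>

definition bad :: "nat \<Rightarrow> 'v \<Rightarrow> 'v \<Rightarrow> 'v set" where
  "bad j b u = {a \<in> nb (Suc j) u (win (Suc j) (\<tau> b u)).
     a = b \<or> (a, b, win j (\<tau> b u)) \<in> joined j \<or> common j a b (win j (\<tau> b u)) = {u}}"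

text \<open>Both directions are required because the weight found at one direction contains a degree
  ratio that only the reversed edge compensates.\<close>

definition spread :: "nat \<Rightarrow> ('v \<times> 'v) set" where
  "spread j = {(b, u) \<in> E. 2 * card (bad j b u) \<le> \<alpha> (Suc j) u b \<and> 2 * card (bad j u b) \<le> \<alpha> (Suc j) b u}"

lemma \<alpha>_ge_1:
  assumes "(b, u) \<in> E"
  shows "1 \<le> \<alpha> j b u"
proof -
  have "u \<in> nb j b (win j (\<tau> b u))" using assms unfolding nb_def by simp
  then have "card (nb j b (win j (\<tau> b u))) \<noteq> 0" using finite_nb by auto
  then show ?thesis unfolding \<alpha>_def deg_def by linarith
qed

text \<open>Let \<open>a\<close> be a neighbour that is not bad, with C common neighbours; then C >=
  2. Each of the C - 1 choices of \<open>v\<close> has weight r / C, together at least r / 2. At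
  least half of the neighbours are not bad, so the edge contributes at least \<rho> / 4. The values
  of \<rho> at an edge and its reversal have product 1, hence sum at least 2.\<close>

lemma card_spread_le:
  "card (spread j) \<le> 4 * (\<Sum>c\<in>quads j. sqrt (outer_weight j c) * sqrt (inner_weight j c))"
proof -
  let ?w = "\<lambda>c. sqrt (outer_weight j c) * sqrt (inner_weight j c)"
  let ?k = "\<lambda>b u. win j (\<tau> b u)" and ?i = "\<lambda>b u. win (Suc j) (\<tau> b u)"
  let ?r = "\<lambda>b u. sqrt (\<alpha> j b u / (\<alpha> j u b * \<alpha> (Suc j) u b * \<alpha> (Suc j) b u))"
  let ?\<rho> = "\<lambda>b u. sqrt (\<alpha> j b u * \<alpha> (Suc j) u b / (\<alpha> j u b * \<alpha> (Suc j) b u))"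
  let ?Q = "\<lambda>b u a. {v \<in> common j a b (?k b u). v \<noteq> u \<and> a \<noteq> b \<and> (a, b, ?k b u) \<notin> joined j}"
  have w: "?w ((b, u), a, v) = ?r b u / card (common j a b (?k b u))" for a b u v
    unfolding outer_weight_def inner_weight_def \<alpha>_def
    by (simp add: real_sqrt_divide real_sqrt_mult \<tau>_sym[of u b] field_simps)
  have finV: "finite (spread j)" unfolding spread_def using finite_E by (rule rev_finite_subset) auto
  have edge: "?\<rho> b u / 4 \<le> (\<Sum>a\<in>nb (Suc j) u (?i b u). \<Sum>v\<in>?Q b u a. ?w ((b, u), a, v))"
    if bu: "(b, u) \<in> spread j" for b u
  proof -
    have e: "(b, u) \<in> E" "(u, b) \<in> E" using bu E_sym unfolding spread_def by auto
    note pos = \<alpha>_ge_1[OF e(1), of j] \<alpha>_ge_1[OF e(1), of "Suc j"] \<alpha>_ge_1[OF e(2), of j] \<alpha>_ge_1[OF e(2), of "Suc j"]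
    have "?\<rho> b u = \<alpha> (Suc j) u b * ?r b u"
    proof -
      have "?\<rho> b u = sqrt ((\<alpha> (Suc j) u b)\<^sup>2 * (\<alpha> j b u / (\<alpha> j u b * \<alpha> (Suc j) u b * \<alpha> (Suc j) b u)))"
        using pos by (simp add: field_simps power2_eq_square)
      also have "\<dots> = sqrt ((\<alpha> (Suc j) u b)\<^sup>2) * ?r b u" by (rule real_sqrt_mult)
      finally show ?thesis using pos by simp
    qed
    then have "?\<rho> b u / 4 = (\<alpha> (Suc j) u b / 2) * (?r b u / 2)" by simp
    also have "\<dots> \<le> card (nb (Suc j) u (?i b u) - bad j b u) * (?r b u / 2)"
    proof (rule mult_right_mono)
      have "card (nb (Suc j) u (?i b u) - bad j b u) = deg (Suc j) u (?i b u) - card (bad j b u)"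
        unfolding deg_def by (rule card_Diff_subset) (auto simp: bad_def finite_nb)
      moreover have "2 * real (card (bad j b u)) \<le> real (deg (Suc j) u (?i b u))"
        using bu unfolding spread_def \<alpha>_def by (auto simp: \<tau>_sym[of u b])
      ultimately show "\<alpha> (Suc j) u b / 2 \<le> real (card (nb (Suc j) u (?i b u) - bad j b u))"
        unfolding \<alpha>_def by (simp add: \<tau>_sym[of u b])
      show "0 \<le> ?r b u / 2" using pos by simp
    qed
    also have "\<dots> = (\<Sum>a\<in>nb (Suc j) u (?i b u) - bad j b u. ?r b u / 2)" by simp
    also have "\<dots> \<le> (\<Sum>a\<in>nb (Suc j) u (?i b u) - bad j b u. \<Sum>v\<in>?Q b u a. ?w ((b, u), a, v))"
    proof (rule sum_mono)
      fix a assume a: "a \<in> nb (Suc j) u (?i b u) - bad j b u"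
      let ?C = "common j a b (?k b u)"
      have fin: "finite ?C" unfolding common_def using finite_nb by auto
      have uC: "u \<in> ?C"
        using a e nb_sym[of u "Suc j" a] unfolding common_def by (auto simp: nb_def win_Suc)
      have "?C \<noteq> {u}" using a unfolding bad_def by auto
      with uC have "{u} \<subset> ?C" by auto
      with fin have "card {u} < card ?C" by (rule psubset_card_mono)
      then have C2: "2 \<le> card ?C" by simp
      have Q: "?Q b u a = ?C - {u}" using a unfolding bad_def by auto
      have "(\<Sum>v\<in>?Q b u a. ?w ((b, u), a, v)) = real (card (?C - {u})) * (?r b u / card ?C)"
        unfolding w Q by simp
      also have "card (?C - {u}) = card ?C - 1" using uC by simp
      finally have "(\<Sum>v\<in>?Q b u a. ?w ((b, u), a, v)) = ?r b u * ((real (card ?C) - 1) / card ?C)"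
        using C2 by (simp add: of_nat_diff)
      moreover have "1 / 2 \<le> (real (card ?C) - 1) / card ?C" using C2 by (simp add: field_simps)
      then have "?r b u * (1/2) \<le> ?r b u * ((real (card ?C) - 1) / card ?C)"
        using pos by (intro mult_left_mono) auto
      ultimately show "?r b u / 2 \<le> (\<Sum>v\<in>?Q b u a. ?w ((b, u), a, v))" by simp
    qed
    also have "\<dots> \<le> (\<Sum>a\<in>nb (Suc j) u (?i b u). \<Sum>v\<in>?Q b u a. ?w ((b, u), a, v))"
      by (rule sum_mono2)
        (auto simp: finite_nb intro!: sum_nonneg mult_nonneg_nonneg outer_weight_nonneg inner_weight_nonneg)
    finally show ?thesis .
  qed
  have swap: "(\<Sum>(b, u)\<in>spread j. ?\<rho> b u) = (\<Sum>(b, u)\<in>spread j. ?\<rho> u b)"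
    by (rule sum.reindex_bij_witness[of _ prod.swap prod.swap]) (auto simp: spread_def E_sym)
  have "2 * real (card (spread j)) = (\<Sum>(b, u)\<in>spread j. 2)" by (simp add: case_prod_beta)
  also have "\<dots> \<le> (\<Sum>(b, u)\<in>spread j. ?\<rho> b u + ?\<rho> u b)"
  proof (rule sum_mono, safe)
    fix b u assume bu: "(b, u) \<in> spread j"
    then have e: "(b, u) \<in> E" "(u, b) \<in> E" using E_sym unfolding spread_def by auto
    note pos = \<alpha>_ge_1[OF e(1), of j] \<alpha>_ge_1[OF e(1), of "Suc j"] \<alpha>_ge_1[OF e(2), of j] \<alpha>_ge_1[OF e(2), of "Suc j"]
    have "?\<rho> b u * ?\<rho> u b = 1"
      using pos by (simp add: field_simps flip: real_sqrt_mult)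
    then show "2 \<le> ?\<rho> b u + ?\<rho> u b"
      by (rule two_le_add_if_mult_eq_1) (use pos in simp_all)
  qed
  also have "\<dots> = 2 * (\<Sum>(b, u)\<in>spread j. ?\<rho> b u)"
    using swap by (simp add: sum.distrib case_prod_beta)
  finally have "real (card (spread j)) \<le> (\<Sum>(b, u)\<in>spread j. ?\<rho> b u)" by simp
  also have "\<dots> = 4 * (\<Sum>(b, u)\<in>spread j. ?\<rho> b u / 4)"
    by (simp add: case_prod_beta sum_distrib_left)
  also have "\<dots> \<le> 4 * (\<Sum>(b, u)\<in>spread j. \<Sum>a\<in>nb (Suc j) u (?i b u). \<Sum>v\<in>?Q b u a. ?w ((b, u), a, v))"
    by (intro mult_left_mono sum_mono) (auto intro: edge)
  also have "\<dots> \<le> 4 * (\<Sum>(b, u)\<in>E. \<Sum>a\<in>nb (Suc j) u (?i b u). \<Sum>v\<in>?Q b u a. ?w ((b, u), a, v))"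
    by (intro mult_left_mono sum_mono2 finite_E)
      (auto simp: spread_def intro!: sum_nonneg mult_nonneg_nonneg outer_weight_nonneg inner_weight_nonneg)
  also have "(\<Sum>(b, u)\<in>E. \<Sum>a\<in>nb (Suc j) u (?i b u). \<Sum>v\<in>?Q b u a. ?w ((b, u), a, v)) = (\<Sum>c\<in>quads j. ?w c)"
  proof -
    have "(\<Sum>c\<in>quads j. ?w c) = (\<Sum>e\<in>E. \<Sum>c\<in>(case e of (b, u) \<Rightarrow> Sigma (nb (Suc j) u (?i b u)) (?Q b u)). ?w (e, c))"
      unfolding quads_def
      by (subst sum.Sigma) (auto simp: finite_E finite_nb common_def intro!: finite_SigmaI)
    also have "\<dots> = (\<Sum>(b, u)\<in>E. \<Sum>a\<in>nb (Suc j) u (?i b u). \<Sum>v\<in>?Q b u a. ?w ((b, u), a, v))"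
      by (rule sum.cong) (auto simp: sum.Sigma finite_nb common_def)
    finally show ?thesis ..
  qed
  finally show ?thesis .
qed

lemma card_spread_sq_le: "(real (card (spread j)))\<^sup>2 \<le> 96 * \<Gamma> j * card pierces"
proof -
  have "(real (card (spread j)))\<^sup>2 \<le> (4 * (\<Sum>c\<in>quads j. sqrt (outer_weight j c) * sqrt (inner_weight j c)))\<^sup>2"
    by (intro power_mono card_spread_le) simp
  then show ?thesis using sum_sqrt_weights_le[of j] by (simp add: power_mult_distrib)
qed

text \<open>Cauchy-Schwarz over the levels. As the \<open>\<Gamma> j\<close> have a sum bounded
  independently of \<open>J\<close>, only one factor \<open>J\<close> appears, whereas the left side
  is quadratic in \<open>J\<close> if many edges are spread on most levels.\<close>

lemma sum_card_spread_le:
  "(\<Sum>j<J. real (card (spread j)))\<^sup>2 \<le> 288 * real J * (real (card pierces))\<^sup>2"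
proof -
  have "(\<Sum>j<J. real (card (spread j)))\<^sup>2 \<le> real J * (\<Sum>j<J. (real (card (spread j)))\<^sup>2)"
    using Cauchy_Schwarz_ineq_sum[of "\<lambda>_. 1" "\<lambda>j. real (card (spread j))" "{..<J}"] by simp
  also have "\<dots> \<le> real J * (\<Sum>j<J. 96 * \<Gamma> j * card pierces)"
    by (intro mult_left_mono sum_mono card_spread_sq_le) simp
  also have "(\<Sum>j<J. 96 * \<Gamma> j * card pierces) = 96 * card pierces * (\<Sum>j<J. \<Gamma> j)"
    by (simp add: sum_distrib_left mult_ac)
  also have "real J * (96 * card pierces * (\<Sum>j<J. \<Gamma> j)) \<le> real J * (96 * card pierces * (3 * real (card pierces)))"
    by (rule mult_left_mono[OF mult_left_mono[OF sum_\<Gamma>_le]]) simp_all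
  finally show ?thesis by (simp add: power2_eq_square mult_ac)
qed

subsection \<open>Degrees at consecutive levels\<close>

lemma \<alpha>_eq: "win j (\<tau> b u) = k \<Longrightarrow> \<alpha> j b u = real (card (nb j b k))"
  unfolding \<alpha>_def deg_def by simp

lemma in_nb: "(b, u) \<in> E \<Longrightarrow> u \<in> nb j b (win j (\<tau> b u))"
  unfolding nb_def by simp

text \<open>Given \<open>a\<close>, \<open>b\<close> and the window, the edges \<open>(b, u)\<close>
  are at most as many as the degree of \<open>b\<close> there, which is the denominator.\<close>

lemma sum_joined_div_\<alpha>_le:
  "(\<Sum>(b, u)\<in>E. real (card {a. (a, b, win j (\<tau> b u)) \<in> joined j}) / \<alpha> j b u) \<le> card (joined j)"
proof -
  let ?A = "\<lambda>(b, u). {a. (a, b, win j (\<tau> b u)) \<in> joined j}"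
  let ?f = "\<lambda>((b, u), a). 1 / \<alpha> j b u" and ?\<phi> = "\<lambda>((b, u), a). (a, b, win j (\<tau> b u))"
  have fin: "finite (?A e)" for e
    using finite_subset[OF _ finite_V, of "?A e"] joined_subset[of j] by (cases e) auto
  have finC: "finite (Sigma E ?A)" using finite_E fin by (rule finite_SigmaI)
  have "(\<Sum>(b, u)\<in>E. real (card {a. (a, b, win j (\<tau> b u)) \<in> joined j}) / \<alpha> j b u) = (\<Sum>e\<in>E. \<Sum>a\<in>?A e. ?f (e, a))"
    by (rule sum.cong) auto
  also have "\<dots> = (\<Sum>c\<in>Sigma E ?A. ?f c)"
    using finite_E fin by (subst sum.Sigma) auto
  also have "\<dots> \<le> card (joined j)"
  proof (rule sum_le_card_of_small_fibres[OF finC finite_joined, where \<phi> = ?\<phi> and N = "\<lambda>(a, b, k). card (nb j b k)"])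
    show "?\<phi> ` Sigma E ?A \<subseteq> joined j" by auto
    fix t assume "t \<in> joined j"
    obtain a b k where t: "t = (a, b, k)" by (cases t)
    have "{c \<in> Sigma E ?A. ?\<phi> c = t} \<subseteq> (\<lambda>u. ((b, u), a)) ` nb j b k" using t in_nb by auto
    then have "card {c \<in> Sigma E ?A. ?\<phi> c = t} \<le> card (nb j b k)" by (rule surj_card_le[OF finite_nb])
    then show "card {c \<in> Sigma E ?A. ?\<phi> c = t} \<le> (\<lambda>(a, b, k). card (nb j b k)) t" using t by simp
  qed (auto simp: \<alpha>_eq)
  finally show ?thesis .
qed

text \<open>Here \<open>u\<close> is determined by \<open>a\<close>, \<open>b\<close> and the child
  window, and it joins \<open>a\<close> and \<open>b\<close> in the parent window, which has
  \<open>K\<close> children.\<close>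

lemma card_thin_le:
  "card {((b, u), a). (b, u) \<in> E \<and> a \<in> nb (Suc j) u (win (Suc j) (\<tau> b u)) \<and> a \<noteq> b \<and>
      common j a b (win j (\<tau> b u)) = {u}} \<le> K * card (joined (Suc j))" (is "card ?C \<le> _")
proof -
  let ?B = "Sigma (joined (Suc j)) (\<lambda>(a, b, i). {k. k div K = i})"
  let ?\<phi> = "\<lambda>((b, u), a). ((a, b, win (Suc j) (\<tau> b u)), win j (\<tau> b u))"
  have "card ?C \<le> card ?B"
  proof (rule card_inj_on_le)
    show "finite ?B" by (auto simp: finite_joined parent_window intro!: finite_SigmaI)
    show "inj_on ?\<phi> ?C"
    proof (rule inj_onI)
      fix x y assume xy: "x \<in> ?C" "y \<in> ?C" "?\<phi> x = ?\<phi> y"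
      obtain b u a where x: "x = ((b, u), a)" by (metis prod.exhaust)
      obtain b' u' a' where y: "y = ((b', u'), a')" by (metis prod.exhaust)
      have eq: "a' = a" "b' = b" "win j (\<tau> b u) = win j (\<tau> b' u')" using xy(3) unfolding x y case_prod_conv prod.inject by blast+
      have "common j a b (win j (\<tau> b u)) = {u}" "common j a' b' (win j (\<tau> b' u')) = {u'}"
        using xy(1,2) unfolding x y by simp_all
      then have "u' = u" using eq by simp
      then show "x = y" using eq unfolding x y by simp
    qed
    show "?\<phi> ` ?C \<subseteq> ?B"
    proof safe
      fix b u a assume h: "(b, u) \<in> E" "a \<in> nb (Suc j) u (win (Suc j) (\<tau> b u))" "a \<noteq> b"
      have "b \<in> nb (Suc j) u (win (Suc j) (\<tau> b u))"
        using in_nb[OF h(1)] nb_sym by simp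
      then show "(a, b, win (Suc j) (\<tau> b u)) \<in> joined (Suc j)" using h joinedI by blast
      show "win j (\<tau> b u) div K = win (Suc j) (\<tau> b u)" by (simp add: win_Suc)
    qed
  qed
  also have "card ?B = (\<Sum>t\<in>joined (Suc j). card (case t of (a, b, i) \<Rightarrow> {k. k div K = i}))"
    by (rule card_SigmaI) (auto simp: finite_joined parent_window)
  also have "\<dots> = (\<Sum>t\<in>joined (Suc j). K)"
    by (rule sum.cong) (auto simp: parent_window)
  finally show ?thesis by (simp add: mult.commute)
qed

text \<open>The child degree of each end is compared with the parent degree of the opposite end: bad
  vertices are parent neighbours of \<open>u\<close>, while the number of vertices joined to
  \<open>b\<close> is controlled on average by the child degree of \<open>b\<close>.\<close>

definition good :: "real \<Rightarrow> nat \<Rightarrow> ('v \<times> 'v) set" where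
  "good H j = {(b, u) \<in> E. H * \<alpha> j b u \<le> \<alpha> (Suc j) u b \<and> H * \<alpha> j u b \<le> \<alpha> (Suc j) b u}"

definition low :: "real \<Rightarrow> nat \<Rightarrow> ('v \<times> 'v) set" where
  "low D j = {(b, u) \<in> E. \<alpha> (Suc j) b u < D}"

lemma card_bad_le:
  "card (bad j b u) \<le> 1 + card {a. (a, b, win j (\<tau> b u)) \<in> joined j}
    + card {a \<in> nb (Suc j) u (win (Suc j) (\<tau> b u)). a \<noteq> b \<and> common j a b (win j (\<tau> b u)) = {u}}"
  (is "_ \<le> 1 + card ?J + card ?T")
proof -
  have "finite ?J" using finite_subset[OF _ finite_V, of ?J] joined_subset[of j] by auto
  moreover have "finite ?T" using finite_nb by auto
  ultimately have "card (bad j b u) \<le> card ({b} \<union> ?J \<union> ?T)"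
    by (intro card_mono) (auto simp: bad_def)
  also have "\<dots> \<le> card {b} + card ?J + card ?T"
    using card_Un_le[of "{b} \<union> ?J" ?T] card_Un_le[of "{b}" ?J] by linarith
  finally show ?thesis by simp
qed

text \<open>The three kinds of bad vertices are averaged separately: those joined to
  \<open>b\<close> by \<open>sum_joined_div_\<alpha>_le\<close>, thanks to the factor
  \<open>H\<close>, and \<open>b\<close> itself and the thin ones, by \<open>card_thin_le\<close>,
  thanks to the minimum degree \<open>D\<close>.\<close>

lemma sum_bad_le:
  assumes "0 < H" "0 < D"
    and G: "G \<subseteq> E" "\<And>b u. (b, u) \<in> G \<Longrightarrow> H * \<alpha> j b u \<le> \<alpha> (Suc j) u b \<and> D \<le> \<alpha> (Suc j) u b"
  shows "(\<Sum>(b, u)\<in>G. card (bad j b u) / \<alpha> (Suc j) u b)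
    \<le> card pierces / H + (card E + K * card pierces) / D"
proof -
  let ?J = "\<lambda>b u. card {a. (a, b, win j (\<tau> b u)) \<in> joined j}"
  let ?T = "\<lambda>b u. {a \<in> nb (Suc j) u (win (Suc j) (\<tau> b u)). a \<noteq> b \<and> common j a b (win j (\<tau> b u)) = {u}}"
  have "(\<Sum>(b, u)\<in>G. card (bad j b u) / \<alpha> (Suc j) u b)
    \<le> (\<Sum>(b, u)\<in>G. 1 / D + (?J b u / \<alpha> j b u) / H + card (?T b u) / D)"
  proof (rule sum_mono, safe)
    fix b u assume bu: "(b, u) \<in> G"
    then have e: "(b, u) \<in> E" "(u, b) \<in> E" using G E_sym by auto
    let ?a = "\<alpha> (Suc j) u b"
    have a: "H * \<alpha> j b u \<le> ?a" "D \<le> ?a" using G(2)[OF bu] by auto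
    have pos: "1 \<le> \<alpha> j b u" "1 \<le> ?a" using \<alpha>_ge_1 e by auto
    have "card (bad j b u) / ?a \<le> (1 + ?J b u + card (?T b u)) / ?a"
      using card_bad_le[of j b u] pos by (intro divide_right_mono) auto
    also have "\<dots> = 1 / ?a + ?J b u / ?a + card (?T b u) / ?a" by (simp add: add_divide_distrib)
    also have "\<dots> \<le> 1 / D + ?J b u / (H * \<alpha> j b u) + card (?T b u) / D"
      using a pos assms(1,2) by (intro add_mono divide_left_mono) auto
    finally show "card (bad j b u) / ?a \<le> 1 / D + (?J b u / \<alpha> j b u) / H + card (?T b u) / D"
      by (simp add: mult.commute)
  qed
  also have "\<dots> \<le> (\<Sum>(b, u)\<in>E. 1 / D + (?J b u / \<alpha> j b u) / H + card (?T b u) / D)"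
    using assms by (intro sum_mono2 finite_E) (auto simp: \<alpha>_def)
  also have "\<dots> = card E / D + (\<Sum>(b, u)\<in>E. ?J b u / \<alpha> j b u) / H + (\<Sum>(b, u)\<in>E. real (card (?T b u))) / D"
    by (simp add: case_prod_beta sum.distrib sum_divide_distrib)
  also have "\<dots> \<le> card E / D + card pierces / H + (K * card pierces) / D"
  proof (intro add_mono divide_right_mono order_refl)
    show "(\<Sum>(b, u)\<in>E. ?J b u / \<alpha> j b u) \<le> card pierces"
      using sum_joined_div_\<alpha>_le[of j] card_joined_le[of j] by linarith
    have "(\<Sum>(b, u)\<in>E. card (?T b u)) = card (Sigma E (\<lambda>(b, u). ?T b u))"
      by (subst card_SigmaI) (auto simp: finite_E finite_nb case_prod_beta)
    also have "Sigma E (\<lambda>(b, u). ?T b u) = {((b, u), a). (b, u) \<in> E \<and> a \<in> nb (Suc j) u (win (Suc j) (\<tau> b u)) \<and> a \<noteq> b \<and>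
      common j a b (win j (\<tau> b u)) = {u}}" by auto
    also have "card \<dots> \<le> K * card (joined (Suc j))" by (rule card_thin_le)
    also have "\<dots> \<le> K * card pierces" using card_joined_le by simp
    finally have "(\<Sum>(b, u)\<in>E. card (?T b u)) \<le> K * card pierces" .
    from of_nat_mono[OF this, where 'a = real]
    show "(\<Sum>(b, u)\<in>E. real (card (?T b u))) \<le> K * card pierces"
      by (simp add: case_prod_beta)
  qed (use assms in auto)
  finally show ?thesis by (simp add: add_divide_distrib)
qed

text \<open>If neither a good edge nor its reversal is low, it fails to be spread only if at least
  half of the neighbours are bad in one direction. Markov's inequality bounds the number of such
  edges (\<open>U\<close>) by \<open>sum_bad_le\<close>.\<close>

lemma card_good_le_spread:
  assumes "0 < H" "0 < D"
  shows "card (good H j) \<le> real (card (spread j)) + 2 * real (card (low D j))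
    + 4 * (card pierces / H + (card E + K * card pierces) / D)"
proof -
  let ?\<beta> = "\<lambda>(b, u). card (bad j b u) / \<alpha> (Suc j) u b"
  define G where "G = good H j - low D j - prod.swap ` low D j"
  define U where "U = {e \<in> G. 1/2 \<le> ?\<beta> e}"
  have low_fin: "finite (low D j)" unfolding low_def using finite_E by (rule rev_finite_subset) auto
  have GE: "G \<subseteq> E" unfolding G_def good_def by auto
  then have fG: "finite G" using finite_E finite_subset by blast
  have G: "H * \<alpha> j b u \<le> \<alpha> (Suc j) u b \<and> D \<le> \<alpha> (Suc j) u b" if "(b, u) \<in> G" for b u
  proof -
    have "(u, b) \<notin> low D j" using that unfolding G_def by force
    moreover have "(u, b) \<in> E" using that GE E_sym by auto
    ultimately show ?thesis using that unfolding G_def good_def low_def by auto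
  qed
  have "card U / 2 = (\<Sum>e\<in>U. 1/2)" by simp
  also have "\<dots> \<le> (\<Sum>e\<in>U. ?\<beta> e)" by (rule sum_mono) (simp add: U_def)
  also have "\<dots> \<le> (\<Sum>e\<in>G. ?\<beta> e)"
    using fG by (intro sum_mono2) (auto simp: U_def \<alpha>_def)
  also have "\<dots> \<le> card pierces / H + (card E + K * card pierces) / D"
    using sum_bad_le[OF assms GE G] .
  finally have U: "real (card U) \<le> 2 * (card pierces / H + (card E + K * card pierces) / D)" by argo
  have fU: "finite U" using fG unfolding U_def by auto
  have Gsym: "(u, b) \<in> G" if "(b, u) \<in> G" for b u
    using that GE unfolding G_def good_def by (auto intro: E_sym)
  have "good H j \<subseteq> spread j \<union> (low D j \<union> prod.swap ` low D j) \<union> (U \<union> prod.swap ` U)"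
  proof (rule subsetI, rule ccontr)
    fix e assume e: "e \<in> good H j"
      "e \<notin> spread j \<union> (low D j \<union> prod.swap ` low D j) \<union> (U \<union> prod.swap ` U)"
    obtain b u where eq: "e = (b, u)" by (cases e)
    have bu: "(b, u) \<in> good H j" "(b, u) \<notin> U" "(b, u) \<notin> prod.swap ` U"
      "(b, u) \<notin> low D j" "(b, u) \<notin> prod.swap ` low D j" "(b, u) \<notin> spread j"
      using e unfolding eq by blast+
    have GG: "(b, u) \<in> G" using bu unfolding G_def by blast
    note GG = GG Gsym[OF GG]
    have "(u, b) \<notin> U" using bu(3) by (metis image_eqI swap_simp)
    then have "?\<beta> (b, u) < 1/2" "?\<beta> (u, b) < 1/2" using bu(2) GG unfolding U_def by auto
    moreover have "(b, u) \<in> E" "(u, b) \<in> E" using GG GE by auto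
    then have "1 \<le> \<alpha> (Suc j) b u" "1 \<le> \<alpha> (Suc j) u b" using \<alpha>_ge_1 by auto
    ultimately show False
      using bu(6) \<open>(b, u) \<in> E\<close> unfolding spread_def by (auto simp: field_simps)
  qed
  then have "card (good H j) \<le> card (spread j \<union> (low D j \<union> prod.swap ` low D j) \<union> (U \<union> prod.swap ` U))"
    using low_fin fU finite_E by (intro card_mono) (auto simp: spread_def intro: rev_finite_subset[OF finite_E])
  also have "\<dots> \<le> card (spread j) + (card (low D j) + card (low D j)) + (card U + card U)"
    using card_Un_le[of "spread j \<union> (low D j \<union> prod.swap ` low D j)" "U \<union> prod.swap ` U"]
      card_Un_le[of "spread j" "low D j \<union> prod.swap ` low D j"]
      card_Un_le[of "low D j" "prod.swap ` low D j"] card_Un_le[of U "prod.swap ` U"]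
      card_image_le[OF low_fin, of prod.swap] card_image_le[OF fU, of prod.swap]
    by linarith
  finally have "real (card (good H j)) \<le> real (card (spread j) + (card (low D j) + card (low D j)) + (card U + card U))"
    by (simp only: of_nat_le_iff)
  then have "real (card (good H j)) \<le> real (card (spread j)) + 2 * real (card (low D j)) + 2 * real (card U)" by simp
  then show ?thesis using U by argo
qed

text \<open>A vertex has fewer than \<open>D\<close> edges in a window where it is low. The number
  of windows is bounded crudely by that for length \<open>s\<close>.\<close>

lemma card_low_le:
  fixes D :: real
  assumes "0 < D" "\<And>b u. (b, u) \<in> E \<Longrightarrow> \<tau> b u < M"
  shows "card (low D j) \<le> D * (card V * (M div s + 1))"
proof -
  let ?\<phi> = "\<lambda>(b, u). (b, win (Suc j) (\<tau> b u))"
  have fin: "finite (low D j)" unfolding low_def using finite_E by (rule rev_finite_subset) auto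
  have "(\<Sum>e\<in>low D j. 1 / D) \<le> card (V \<times> {..M div s})"
  proof (rule sum_le_card_of_fibres[OF fin, of _ ?\<phi>])
    show "finite (V \<times> {..M div s})" using finite_V by simp
    show "?\<phi> ` low D j \<subseteq> V \<times> {..M div s}"
    proof safe
      fix b u assume "(b, u) \<in> low D j"
      then have e: "(b, u) \<in> E" unfolding low_def by auto
      then show "b \<in> V" using E_subset by auto
      have "win (Suc j) (\<tau> b u) \<le> \<tau> b u div s"
        unfolding win_def div_mult2_eq by simp
      also have "\<dots> \<le> M div s" using assms(2)[OF e] by (intro div_le_mono) simp
      finally show "win (Suc j) (\<tau> b u) \<le> M div s" .
    qed
    fix t assume "t \<in> V \<times> {..M div s}"
    obtain b i where t: "t = (b, i)" by (cases t)
    let ?F = "{e \<in> low D j. ?\<phi> e = t}"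
    show "(\<Sum>e\<in>?F. 1 / D) \<le> 1"
    proof (cases "?F = {}")
      case True
      then show ?thesis by (simp only: sum.empty zero_le_one)
    next
      case False
      then obtain u where u: "(b, u) \<in> low D j" "win (Suc j) (\<tau> b u) = i" using t by auto
      have "?F \<subseteq> (\<lambda>u. (b, u)) ` nb (Suc j) b i" using t by (auto simp: low_def nb_def)
      then have "card ?F \<le> card (nb (Suc j) b i)" by (rule surj_card_le[OF finite_nb])
      moreover have "real (card (nb (Suc j) b i)) < D"
        using u \<alpha>_eq[OF u(2)] unfolding low_def by auto
      ultimately have "real (card ?F) \<le> D" by linarith
      then show ?thesis using assms(1) by (simp add: divide_le_eq_1)
    qed
  qed
  then have "card (low D j) / D \<le> card V * (M div s + 1)"
    by (simp add: card_cartesian_product)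
  then show ?thesis using assms(1) by (simp add: divide_le_eq mult.commute)
qed

text \<open>Write the numerator as a sum over neighbours \<open>v\<close> of \<open>b\<close> in the
  parent window. For fixed \<open>(b, v)\<close> and a fixed one of the \<open>K\<close> children,
  the number of \<open>u\<close> is the denominator.\<close>

lemma sum_\<alpha>_Suc_div_\<alpha>_le: "(\<Sum>(b, u)\<in>E. \<alpha> (Suc j) b u / \<alpha> j b u) \<le> K * card E"
proof -
  let ?N = "\<lambda>(b, u). nb (Suc j) b (win (Suc j) (\<tau> b u))"
  let ?f = "\<lambda>((b, u), v). 1 / \<alpha> j b u" and ?\<phi> = "\<lambda>((b, u), v). ((b, v), win j (\<tau> b u))"
  let ?B = "Sigma E (\<lambda>(b, v). {k. k div K = win (Suc j) (\<tau> b v)})"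
  have finC: "finite (Sigma E ?N)" using finite_E finite_nb by (auto intro!: finite_SigmaI)
  have finB: "finite ?B" using finite_E by (auto simp: parent_window intro!: finite_SigmaI)
  have "(\<Sum>(b, u)\<in>E. \<alpha> (Suc j) b u / \<alpha> j b u) = (\<Sum>e\<in>E. \<Sum>v\<in>?N e. ?f (e, v))"
    by (rule sum.cong) (auto simp: \<alpha>_def deg_def)
  also have "\<dots> = (\<Sum>c\<in>Sigma E ?N. ?f c)"
    using finite_E finite_nb by (subst sum.Sigma) auto
  also have "\<dots> \<le> card ?B"
  proof (rule sum_le_card_of_small_fibres[OF finC finB, where \<phi> = ?\<phi> and N = "\<lambda>((b, v), k). card (nb j b k)"])
    show "?\<phi> ` Sigma E ?N \<subseteq> ?B" by (auto simp: nb_def win_Suc)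
    fix t assume "t \<in> ?B"
    obtain b v k where t: "t = ((b, v), k)" by (metis prod.exhaust)
    have "{c \<in> Sigma E ?N. ?\<phi> c = t} \<subseteq> (\<lambda>u. ((b, u), v)) ` nb j b k" using t in_nb by auto
    then have "card {c \<in> Sigma E ?N. ?\<phi> c = t} \<le> card (nb j b k)" by (rule surj_card_le[OF finite_nb])
    then show "card {c \<in> Sigma E ?N. ?\<phi> c = t} \<le> (\<lambda>((b, v), k). card (nb j b k)) t" using t by simp
  qed (auto simp: \<alpha>_eq)
  also have "card ?B = (\<Sum>e\<in>E. card (case e of (b, v) \<Rightarrow> {k. k div K = win (Suc j) (\<tau> b v)}))"
    by (rule card_SigmaI) (auto simp: finite_E parent_window)
  also have "\<dots> = (\<Sum>e\<in>E. K)"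
    by (rule sum.cong) (auto simp: parent_window)
  finally show ?thesis by (simp add: mult.commute)
qed

text \<open>Write the numerator as a sum over neighbours \<open>v\<close> of \<open>b\<close>. The
  term \<open>v = u\<close> costs at most 1 per edge; otherwise \<open>b\<close> joins
  \<open>u\<close> and \<open>v\<close>, and given these and the window there are at most
  \<open>\<alpha> j u b\<close> choices for \<open>b\<close>.\<close>

lemma sum_\<alpha>_div_swap_le: "(\<Sum>(b, u)\<in>E. \<alpha> j b u / \<alpha> j u b) \<le> card pierces + card E"
proof -
  let ?N = "\<lambda>(b, u). nb j b (win j (\<tau> b u)) - {u}"
  let ?f = "\<lambda>((b, u), v). 1 / \<alpha> j u b" and ?\<phi> = "\<lambda>((b, u), v). (u, v, win j (\<tau> b u))"
  have finC: "finite (Sigma E ?N)" using finite_E finite_nb by (auto intro!: finite_SigmaI)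
  have "(\<Sum>(b, u)\<in>E. \<alpha> j b u / \<alpha> j u b) \<le> (\<Sum>e\<in>E. 1 + (\<Sum>v\<in>?N e. ?f (e, v)))"
  proof (rule sum_mono)
    fix e assume "e \<in> E"
    then obtain b u where eq: "e = (b, u)" and e: "(b, u) \<in> E" by (cases e) auto
    have "\<alpha> j b u = real (card (nb j b (win j (\<tau> b u)) - {u})) + 1"
      using in_nb[OF e, of j] card_Suc_Diff1[OF finite_nb in_nb[OF e, of j]]
      unfolding \<alpha>_def deg_def by linarith
    moreover have "1 \<le> \<alpha> j u b" using \<alpha>_ge_1 E_sym e by blast
    ultimately show "(case e of (b, u) \<Rightarrow> \<alpha> j b u / \<alpha> j u b) \<le> 1 + (\<Sum>v\<in>?N e. ?f (e, v))"
      by (simp add: add_divide_distrib eq)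
  qed
  also have "\<dots> = card E + (\<Sum>c\<in>Sigma E ?N. ?f c)"
    using finite_E finite_nb by (subst sum.Sigma[symmetric]) (auto simp: sum.distrib)
  also have "(\<Sum>c\<in>Sigma E ?N. ?f c) \<le> card (joined j)"
  proof (rule sum_le_card_of_small_fibres[OF finC finite_joined, where \<phi> = ?\<phi> and N = "\<lambda>(u, v, k). card (nb j u k)"])
    show "?\<phi> ` Sigma E ?N \<subseteq> joined j" using in_nb by (auto intro!: joinedI)
    fix t assume "t \<in> joined j"
    obtain u v k where t: "t = (u, v, k)" by (cases t)
    have "{c \<in> Sigma E ?N. ?\<phi> c = t} \<subseteq> (\<lambda>b. ((b, u), v)) ` nb j u k"
    proof
      fix c assume "c \<in> {c \<in> Sigma E ?N. ?\<phi> c = t}"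
      then obtain b where c: "c = ((b, u), v)" "(b, u) \<in> E" "win j (\<tau> b u) = k" using t by auto
      then have "b \<in> nb j u k" using in_nb[of b u j] nb_sym[of u j b k] by simp
      then show "c \<in> (\<lambda>b. ((b, u), v)) ` nb j u k" using c by simp
    qed
    then have "card {c \<in> Sigma E ?N. ?\<phi> c = t} \<le> card (nb j u k)" by (rule surj_card_le[OF finite_nb])
    then show "card {c \<in> Sigma E ?N. ?\<phi> c = t} \<le> (\<lambda>(u, v, k). card (nb j u k)) t" using t by simp
  qed (auto simp: \<alpha>_def deg_def \<tau>_sym)
  also have "real (card (joined j)) \<le> card pierces" by (simp add: card_joined_le)
  finally show ?thesis by simp
qed

text \<open>With a single window the reciprocals of the degrees sum to at most 1 at each vertex.
  Concavity of \<open>ln\<close>, in the form \<open>ln x <= x - 1\<close>, does the rest.\<close>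

lemma sum_ln_\<alpha>_top_ge:
  assumes "\<And>b u. (b, u) \<in> E \<Longrightarrow> win J (\<tau> b u) = 0" "E \<noteq> {}"
  shows "card E * ln (card E / card V) \<le> (\<Sum>(b, u)\<in>E. ln (\<alpha> J b u))"
proof -
  let ?m = "real (card E)" and ?n = "real (card V)"
  have m: "0 < ?m" using assms(2) finite_E by (simp add: card_gt_0_iff)
  have "V \<noteq> {}" using assms(2) E_subset by auto
  then have n: "0 < ?n" using finite_V by (simp add: card_gt_0_iff)
  have "(\<Sum>e\<in>E. case e of (b, u) \<Rightarrow> 1 / \<alpha> J b u) \<le> ?n"
  proof (rule sum_le_card_of_small_fibres[OF finite_E finite_V, where \<phi> = fst and N = "\<lambda>b. card (nb J b 0)"])
    show "fst ` E \<subseteq> V" using E_subset by auto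
    fix b
    have "{e \<in> E. fst e = b} \<subseteq> (\<lambda>u. (b, u)) ` nb J b 0" using assms(1) by (auto simp: nb_def)
    then show "card {e \<in> E. fst e = b} \<le> card (nb J b 0)" by (rule surj_card_le[OF finite_nb])
  qed (auto simp: \<alpha>_eq assms(1))
  then have le: "(\<Sum>(b, u)\<in>E. 1 / \<alpha> J b u) \<le> ?n" .
  have "(\<Sum>(b, u)\<in>E. ln (?m / ?n) - ln (\<alpha> J b u)) \<le> (\<Sum>(b, u)\<in>E. (?m / ?n) * (1 / \<alpha> J b u) - 1)"
  proof (rule sum_mono, safe)
    fix b u assume "(b, u) \<in> E"
    then have "1 \<le> \<alpha> J b u" by (rule \<alpha>_ge_1)
    then show "ln (?m / ?n) - ln (\<alpha> J b u) \<le> (?m / ?n) * (1 / \<alpha> J b u) - 1"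
      using ln_le_minus_one[of "(?m / ?n) * (1 / \<alpha> J b u)"] m n
      by (simp add: ln_div ln_mult)
  qed
  also have "\<dots> = (?m / ?n) * (\<Sum>(b, u)\<in>E. 1 / \<alpha> J b u) - ?m"
    by (simp add: case_prod_beta sum_subtractf sum_distrib_left)
  also have "\<dots> \<le> (?m / ?n) * ?n - ?m"
    using le m n by (intro diff_right_mono mult_left_mono) auto
  also have "\<dots> = 0" using n by simp
  finally show ?thesis by (simp add: case_prod_beta sum_subtractf)
qed

text \<open>Only an edge and its reversal share a position, which accounts for the factor 2.\<close>

lemma card_window_le: "card {(b, u) \<in> E. win 0 (\<tau> b u) = i} \<le> 2 * s"
proof -
  let ?F = "{e \<in> E. win 0 (\<tau> (fst e) (snd e)) = i}" and ?\<tau> = "\<lambda>e. \<tau> (fst e) (snd e)"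
  have fin: "finite ?F" using finite_E by auto
  have sub: "?\<tau> ` ?F \<subseteq> {i * s..<i * s + s}"
  proof (rule image_subsetI)
    fix e assume "e \<in> ?F"
    then have i: "?\<tau> e div s = i" by (simp add: win_def)
    have "?\<tau> e = ?\<tau> e div s * s + ?\<tau> e mod s" by simp
    then show "?\<tau> e \<in> {i * s..<i * s + s}"
      using mod_less_divisor[OF s_pos, of "?\<tau> e"] unfolding i atLeastLessThan_iff by linarith
  qed
  have "card ?F = (\<Sum>p\<in>{i * s..<i * s + s}. card {e \<in> ?F. ?\<tau> e = p})"
    using sum.group[OF fin _ sub, of "\<lambda>_. 1::nat"] by simp
  also have "\<dots> \<le> (\<Sum>p\<in>{i * s..<i * s + s}. 2)"
  proof (rule sum_mono)
    fix p
    show "card {e \<in> ?F. ?\<tau> e = p} \<le> 2"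
    proof (cases "{e \<in> ?F. ?\<tau> e = p} = {}")
      case True
      then show ?thesis by (simp only: card.empty)
    next
      case False
      then obtain b u where "(b, u) \<in> E" "\<tau> b u = p" by auto
      then have "{e \<in> ?F. ?\<tau> e = p} \<subseteq> {(b, u), (u, b)}" using \<tau>_inj by fastforce
      then have "card {e \<in> ?F. ?\<tau> e = p} \<le> card {(b, u), (u, b)}" by (intro card_mono) auto
      also have "\<dots> \<le> 2" by (simp add: card_insert_le_m1)
      finally show ?thesis .
    qed
  qed
  finally have "card ?F \<le> 2 * s" by simp
  moreover have "?F = {(b, u) \<in> E. win 0 (\<tau> b u) = i}" by auto
  ultimately show ?thesis by simp
qed

text \<open>The product of the degrees of both ends counts pairs of edges \<open>(b, v)\<close>,
  \<open>(u, a)\<close> of one window, and these determine \<open>(b, u)\<close>, \<open>v\<close>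
  and \<open>a\<close>. So the product is at most \<open>2 * s\<close> on average; bounding each
  degree by \<open>s\<close> would only give twice \<open>ln s\<close>.\<close>

lemma sum_ln_\<alpha>_bottom_le:
  "(\<Sum>(b, u)\<in>E. ln (\<alpha> 0 b u) + ln (\<alpha> 0 u b)) \<le> card E * ln (2 * s)"
proof -
  let ?k = "\<lambda>(b, u). win 0 (\<tau> b u)"
  let ?N = "\<lambda>(b, u). nb 0 b (win 0 (\<tau> b u)) \<times> nb 0 u (win 0 (\<tau> b u))"
  let ?W = "Sigma E (\<lambda>e. {e' \<in> E. ?k e' = ?k e})"
  have finW: "finite ?W" using finite_E by (auto intro!: finite_SigmaI)
  have "(\<Sum>e\<in>E. card (?N e)) = card (Sigma E ?N)"
    using finite_E finite_nb by (subst card_SigmaI) auto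
  also have "\<dots> \<le> card ?W"
  proof (rule card_inj_on_le[OF _ _ finW, of "\<lambda>((b, u), v, a). ((b, v), (u, a))"])
    show "inj_on (\<lambda>((b, u), v, a). ((b, v), (u, a))) (Sigma E ?N)" by (auto simp: inj_on_def)
    show "(\<lambda>((b, u), v, a). ((b, v), (u, a))) ` Sigma E ?N \<subseteq> ?W" by (auto simp: nb_def)
  qed
  also have "card ?W = (\<Sum>e\<in>E. card {e' \<in> E. ?k e' = ?k e})"
    using finite_E by (subst card_SigmaI) auto
  also have "\<dots> \<le> (\<Sum>e\<in>E. 2 * s)"
  proof (rule sum_mono)
    fix e
    have "{e' \<in> E. ?k e' = ?k e} = {(b, u) \<in> E. win 0 (\<tau> b u) = ?k e}" by auto
    then show "card {e' \<in> E. ?k e' = ?k e} \<le> 2 * s" using card_window_le by simp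
  qed
  finally have le: "(\<Sum>e\<in>E. card (?N e)) \<le> card E * (2 * s)" by simp
  have "(\<Sum>(b, u)\<in>E. \<alpha> 0 b u * \<alpha> 0 u b) = (\<Sum>e\<in>E. real (card (?N e)))"
    by (rule sum.cong) (auto simp: \<alpha>_def deg_def card_cartesian_product \<tau>_sym)
  then have le: "(\<Sum>(b, u)\<in>E. \<alpha> 0 b u * \<alpha> 0 u b) \<le> card E * (2 * real s)"
    using of_nat_mono[OF le, where 'a = real] by simp
  have s: "0 < real s" using s_pos by simp
  have "(\<Sum>(b, u)\<in>E. ln (\<alpha> 0 b u) + ln (\<alpha> 0 u b) - ln (2 * s)) \<le> (\<Sum>(b, u)\<in>E. \<alpha> 0 b u * \<alpha> 0 u b / (2 * s) - 1)"
  proof (rule sum_mono, safe)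
    fix b u assume "(b, u) \<in> E"
    then have "1 \<le> \<alpha> 0 b u" "1 \<le> \<alpha> 0 u b" using \<alpha>_ge_1 E_sym by auto
    then show "ln (\<alpha> 0 b u) + ln (\<alpha> 0 u b) - ln (2 * s) \<le> \<alpha> 0 b u * \<alpha> 0 u b / (2 * s) - 1"
      using ln_le_minus_one[of "\<alpha> 0 b u * \<alpha> 0 u b / (2 * s)"] s
      by (simp add: ln_div ln_mult)
  qed
  also have "\<dots> = (\<Sum>(b, u)\<in>E. \<alpha> 0 b u * \<alpha> 0 u b) / (2 * s) - card E"
    by (simp add: case_prod_beta sum_subtractf sum_divide_distrib)
  also have "\<dots> \<le> 0" using le s by (simp add: field_simps)
  finally show ?thesis by (simp add: case_prod_beta sum_subtractf sum.distrib)
qed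

lemma sum_E_swap: "(\<Sum>(b, u)\<in>E. f u b) = (\<Sum>(b, u)\<in>E. f b u)"
  by (rule sum.reindex_bij_witness[of _ prod.swap prod.swap]) (auto simp: E_sym)

text \<open>Sums \<open>ln_drop_le\<close> over all edges. On average, degrees grow by at most a
  factor \<open>K\<close>, and the imbalance ratios are controlled by the piercings.\<close>

lemma sum_ln_drop_le:
  assumes H: "1 \<le> H" and l: "1 \<le> l"
  shows "(\<Sum>(b, u)\<in>E. ln (\<alpha> (Suc j) b u) + ln (\<alpha> (Suc j) u b) - ln (\<alpha> j b u) - ln (\<alpha> j u b))
    \<le> 2 * ln K * card (good H j) + card E * (2 + 2 * ln H + 2 * ln l)
      + 4 * (real (card pierces) + real (card E)) / l"
proof -
  let ?A = "\<lambda>b u. \<alpha> j b u" and ?B = "\<lambda>b u. \<alpha> (Suc j) b u"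
  let ?g = "\<lambda>b u. if (b, u) \<in> good H j then 2 * ln K else 0"
  have "(\<Sum>(b, u)\<in>E. ln (?B b u) + ln (?B u b) - ln (?A b u) - ln (?A u b))
    \<le> (\<Sum>(b, u)\<in>E. ?g b u + (?B b u / ?A b u + ?B u b / ?A u b) / K + (2 * ln H + 2 * ln l)
        + (?A b u / ?A u b + ?A u b / ?A b u + ?B b u / ?B u b + ?B u b / ?B b u) / l)"
  proof (rule sum_mono)
    fix e assume "e \<in> E"
    then obtain b u where eq: "e = (b, u)" and e: "(b, u) \<in> E" "(u, b) \<in> E" using E_sym by (cases e) auto
    have pos: "0 < ?A b u" "0 < ?A u b" "0 < ?B b u" "0 < ?B u b"
      using \<alpha>_ge_1[OF e(1), of j] \<alpha>_ge_1[OF e(1), of "Suc j"] \<alpha>_ge_1[OF e(2), of j] \<alpha>_ge_1[OF e(2), of "Suc j"]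
      by linarith+
    have g: "(b, u) \<in> good H j \<longleftrightarrow> H * ?A b u \<le> ?B u b \<and> H * ?A u b \<le> ?B b u"
      using e unfolding good_def by auto
    show "(case e of (b, u) \<Rightarrow> ln (?B b u) + ln (?B u b) - ln (?A b u) - ln (?A u b)) \<le>
      (case e of (b, u) \<Rightarrow> ?g b u + (?B b u / ?A b u + ?B u b / ?A u b) / K + (2 * ln H + 2 * ln l)
        + (?A b u / ?A u b + ?A u b / ?A b u + ?B b u / ?B u b + ?B u b / ?B b u) / l)"
      unfolding eq case_prod_conv by (rule ln_drop_le[OF pos H l K_pos g])
  qed
  also have "\<dots> = (\<Sum>(b, u)\<in>E. ?g b u)
      + ((\<Sum>(b, u)\<in>E. ?B b u / ?A b u) + (\<Sum>(b, u)\<in>E. ?B u b / ?A u b)) / K + card E * (2 * ln H + 2 * ln l)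
      + ((\<Sum>(b, u)\<in>E. ?A b u / ?A u b) + (\<Sum>(b, u)\<in>E. ?A u b / ?A b u)
        + (\<Sum>(b, u)\<in>E. ?B b u / ?B u b) + (\<Sum>(b, u)\<in>E. ?B u b / ?B b u)) / l"
    by (simp add: case_prod_beta sum.distrib sum_divide_distrib add_divide_distrib)
  also have "(\<Sum>(b, u)\<in>E. ?B u b / ?A u b) = (\<Sum>(b, u)\<in>E. ?B b u / ?A b u)"
    by (rule sum_E_swap)
  also have "(\<Sum>(b, u)\<in>E. ?A u b / ?A b u) = (\<Sum>(b, u)\<in>E. ?A b u / ?A u b)"
    by (rule sum_E_swap)
  also have "(\<Sum>(b, u)\<in>E. ?B u b / ?B b u) = (\<Sum>(b, u)\<in>E. ?B b u / ?B u b)"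
    by (rule sum_E_swap)
  also have "(\<Sum>(b, u)\<in>E. ?g b u) = 2 * ln K * card (good H j)"
  proof -
    have "(\<Sum>(b, u)\<in>E. ?g b u) = (\<Sum>e\<in>E. if e \<in> good H j then 2 * ln K else 0)"
      by (rule sum.cong) auto
    also have "\<dots> = (\<Sum>e\<in>E \<inter> good H j. 2 * ln K)" using finite_E by (rule sum.inter_restrict[symmetric])
    also have "E \<inter> good H j = good H j" unfolding good_def by auto
    finally show ?thesis by simp
  qed
  also have "2 * ln K * card (good H j) + ((\<Sum>(b, u)\<in>E. ?B b u / ?A b u) + (\<Sum>(b, u)\<in>E. ?B b u / ?A b u)) / K
      + card E * (2 * ln H + 2 * ln l)
      + ((\<Sum>(b, u)\<in>E. ?A b u / ?A u b) + (\<Sum>(b, u)\<in>E. ?A b u / ?A u b)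
        + (\<Sum>(b, u)\<in>E. ?B b u / ?B u b) + (\<Sum>(b, u)\<in>E. ?B b u / ?B u b)) / l
    \<le> 2 * ln K * card (good H j) + (real K * card E + real K * card E) / K + card E * (2 * ln H + 2 * ln l)
      + ((card pierces + card E) + (card pierces + card E) + (card pierces + card E) + (card pierces + card E)) / l"
    using l sum_\<alpha>_Suc_div_\<alpha>_le[of j] sum_\<alpha>_div_swap_le[of j] sum_\<alpha>_div_swap_le[of "Suc j"]
    by (intro add_mono order_refl divide_right_mono) auto
  also have "\<dots> = 2 * ln K * card (good H j) + card E * (2 + 2 * ln H + 2 * ln l)
      + 4 * (real (card pierces) + real (card E)) / l"
    using K_pos by (simp add: algebra_simps)
  finally show ?thesis .
qed

text \<open>From bottom to top the two logarithmic degrees of an edge grow, on average, by at least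
  \<open>(J - 2) * ln K\<close> in total. Levels where an edge is not good contribute little, the
  others about \<open>2 * ln K\<close> at most, so edges are good on a positive proportion of the
  levels. Nearly all of these are spread, and \<open>sum_card_spread_le\<close> applies.\<close>

theorem card_pierces_ge:
  fixes \<Lambda> :: real and J :: nat
  assumes E: "E \<noteq> {}" and \<tau>: "\<And>b u. (b, u) \<in> E \<Longrightarrow> \<tau> b u < card E"
    and \<Lambda>: "1 \<le> \<Lambda>" "card pierces \<le> \<Lambda> * card E"
    and K: "10 * (3 + 2 * ln (200 * \<Lambda>) + 2 * ln (8 * \<Lambda>)) \<le> ln K" "2 * (real (card V))\<^sup>2 \<le> K * card E"
    and s: "80000 * K * \<Lambda> * card V \<le> s" "s * K ^ (J - 1) \<le> card E" "card E \<le> s * K ^ J" and J: "4 \<le> J"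
  shows "card E * sqrt J \<le> 122 * real (card pierces)"
proof -
  define m X n where "m = real (card E)" and "X = real (card pierces)" and "n = real (card V)"
  \<comment> \<open>With \<open>X <= \<Lambda> * m\<close> these make \<open>X / H\<close> and
    \<open>(m + K * X) / D\<close> at most \<open>m / 200\<close> each.\<close>
  define H D where "H = 200 * \<Lambda>" and "D = 400 * K * \<Lambda>"
  have m: "0 < m" using E finite_E unfolding m_def by (simp add: card_gt_0_iff)
  have "V \<noteq> {}" using E E_subset by auto
  then have n: "0 < n" unfolding n_def using finite_V by (simp add: card_gt_0_iff)
  have K1: "1 \<le> real K" and s0: "0 < real s" using K_pos s_pos by auto
  have XL: "X \<le> \<Lambda> * m" using \<Lambda> unfolding X_def m_def by simp
  have HD: "1 \<le> H" "0 < D" "0 < H" unfolding H_def D_def using \<Lambda>(1) K1 by auto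
  have KL: "1 \<le> K * \<Lambda>" using mult_mono[OF K1 \<Lambda>(1)] by simp
  have "0 \<le> ln (200 * \<Lambda>)" "0 \<le> ln (8 * \<Lambda>)" using \<Lambda>(1) by (auto intro!: ln_ge_zero)
  then have lnK: "0 < ln K" using K(1) by argo
  have sm: "real s * real K ^ (J - 1) \<le> m"
    using s(2) unfolding m_def by (metis of_nat_le_iff of_nat_mult of_nat_power)
  have "real s * 1 \<le> real s * real K ^ (J - 1)"
    using s0 K1 by (intro mult_left_mono one_le_power) auto
  then have s_le: "real s \<le> m" using sm by simp

  have low: "real (card (low D j)) \<le> m / 100" for j
  proof -
    have "real (card (low D j)) \<le> D * (n * (card E div s + 1))"
      using card_low_le[OF HD(2) \<tau>, of j] unfolding n_def by (simp only: of_nat_mult)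
    also have "\<dots> \<le> D * (n * (m / s + m / s))"
    proof (intro mult_left_mono)
      have "real (card E div s) \<le> m / s" unfolding m_def by (rule of_nat_div_le_of_nat)
      moreover have "1 \<le> m / s" using s_le s0 by simp
      ultimately show "real (card E div s + 1) \<le> m / s + m / s" by simp
    qed (use n HD in auto)
    also have "\<dots> = (80000 * K * \<Lambda> * n) * m / (100 * s)" unfolding D_def by (simp add: field_simps)
    also have "\<dots> \<le> s * m / (100 * s)"
      using s(1) m unfolding n_def by (intro divide_right_mono mult_right_mono) auto
    also have "\<dots> = m / 100" using s0 by simp
    finally show ?thesis .
  qed
  \<comment> \<open>The loss is 2 / 100 for the low edges and 4 * (1 / 200 + 1 / 200) for the
    rest.\<close>
  have spread: "real (card (good H j)) \<le> real (card (spread j)) + 6 / 100 * m" for j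
  proof -
    have "X / H \<le> m / 200"
      using XL \<Lambda>(1) unfolding H_def by (simp add: field_simps)
    moreover have "(m + K * X) / D \<le> m / 200"
    proof -
      have "m + K * X \<le> (K * \<Lambda>) * m + K * (\<Lambda> * m)"
        using XL KL m by (intro add_mono mult_left_mono) auto
      then show ?thesis unfolding D_def using \<Lambda>(1) K1 by (simp add: field_simps)
    qed
    moreover have "real (card (good H j)) \<le> real (card (spread j)) + 2 * real (card (low D j)) + 4 * (X / H + (m + K * X) / D)"
      using card_good_le_spread[OF HD(3,2), of j] unfolding X_def m_def of_nat_add of_nat_mult .
    ultimately show ?thesis using low[of j] by argo
  qed

  have drop: "(\<Sum>(b, u)\<in>E. ln (\<alpha> (Suc j) b u) + ln (\<alpha> (Suc j) u b) - ln (\<alpha> j b u) - ln (\<alpha> j u b))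
      \<le> 2 * ln K * card (good H j) + m * (ln K / 10)" for j
  proof -
    \<comment> \<open>The value \<open>8 * \<Lambda>\<close> for \<open>l\<close> brings the
      imbalance term down to at most \<open>m\<close>.\<close>
    have "(\<Sum>(b, u)\<in>E. ln (\<alpha> (Suc j) b u) + ln (\<alpha> (Suc j) u b) - ln (\<alpha> j b u) - ln (\<alpha> j u b))
      \<le> 2 * ln K * card (good H j) + m * (2 + 2 * ln H + 2 * ln (8 * \<Lambda>)) + 4 * (X + m) / (8 * \<Lambda>)"
      using sum_ln_drop_le[of H "8 * \<Lambda>" j] HD \<Lambda>(1) unfolding m_def X_def by simp
    also have "4 * (X + m) / (8 * \<Lambda>) \<le> m"
    proof -
      have "m \<le> \<Lambda> * m" using m \<Lambda>(1) by simp
      then have "4 * (X + m) \<le> m * (8 * \<Lambda>)" using XL by (simp add: algebra_simps)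
      then show ?thesis using \<Lambda>(1) by (simp add: divide_le_eq)
    qed
    also have "2 * ln K * card (good H j) + m * (2 + 2 * ln H + 2 * ln (8 * \<Lambda>)) + m
      = 2 * ln K * card (good H j) + m * (3 + 2 * ln H + 2 * ln (8 * \<Lambda>))" by (simp add: algebra_simps)
    also have "\<dots> \<le> 2 * ln K * card (good H j) + m * (ln K / 10)"
      using K(1) m unfolding H_def by (intro add_left_mono mult_left_mono) auto
    finally show ?thesis by simp
  qed
  let ?L = "\<lambda>j. \<Sum>(b, u)\<in>E. ln (\<alpha> j b u) + ln (\<alpha> j u b)"
  have "?L J - ?L 0 = (\<Sum>j<J. ?L (Suc j) - ?L j)" by (rule sum_lessThan_telescope[symmetric])
  also have "\<dots> \<le> (\<Sum>j<J. 2 * ln K * card (good H j) + m * (ln K / 10))"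
    using drop by (intro sum_mono) (simp add: case_prod_beta sum_subtractf sum.distrib algebra_simps)
  also have "\<dots> = 2 * ln K * (\<Sum>j<J. real (card (good H j))) + J * m * (ln K / 10)"
    by (simp add: sum.distrib sum_distrib_left)
  finally have up: "?L J - ?L 0 \<le> 2 * ln K * (\<Sum>j<J. real (card (good H j))) + J * m * (ln K / 10)" .
  have "win J (\<tau> b u) = 0" if "(b, u) \<in> E" for b u
    using \<tau>[OF that] s(3) unfolding win_def by simp
  then have "2 * (m * ln (m / n)) \<le> ?L J"
    using sum_ln_\<alpha>_top_ge[of J] E sum_E_swap[of "\<lambda>b u. ln (\<alpha> J b u)"]
    unfolding m_def n_def by (simp add: case_prod_beta sum.distrib)
  moreover have "?L 0 \<le> m * ln (2 * s)" using sum_ln_\<alpha>_bottom_le unfolding m_def by simp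
  \<comment> \<open>\<open>2 * ln (m / n) - ln (2 * s)\<close> is \<open>ln (m / s)\<close>, worth
    \<open>J - 1\<close> levels, minus \<open>ln (2 * n^2 / m)\<close>, which costs at most one
    level.\<close>
  moreover have "m * ((J - 2) * ln K) \<le> 2 * (m * ln (m / n)) - m * ln (2 * s)"
  proof -
    have "ln (real K ^ (J - 1)) \<le> ln (m / s)"
      using sm s0 K1 m by (subst ln_le_cancel_iff) (auto simp: field_simps)
    moreover have "ln (2 * n\<^sup>2 / m) \<le> ln K"
      using K(2) n m K1 unfolding n_def m_def by (subst ln_le_cancel_iff) (auto simp: field_simps)
    moreover have "ln (real K ^ (J - 1)) = (J - 1) * ln K" using K_pos by (simp add: ln_realpow)
    moreover have "real (J - 1) = real (J - 2) + 1" using J by simp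
    moreover have "2 * ln (m / n) - ln (2 * s) = ln (m / s) - ln (2 * n\<^sup>2 / m)"
      using m n s0 by (simp add: ln_div ln_mult ln_realpow)
    ultimately have "(J - 2) * ln K \<le> 2 * ln (m / n) - ln (2 * s)"
      by (simp add: algebra_simps)
    then have "m * ((J - 2) * ln K) \<le> m * (2 * ln (m / n) - ln (2 * s))"
      using m by (intro mult_left_mono) auto
    then show ?thesis by (simp add: algebra_simps)
  qed
  ultimately have "m * ((J - 2) * ln K) \<le> 2 * ln K * (\<Sum>j<J. real (card (good H j))) + J * m * (ln K / 10)"
    using up by linarith
  then have "ln K * (m * (J - 2) - J * m / 10) \<le> ln K * (2 * (\<Sum>j<J. real (card (good H j))))"
    by (simp add: algebra_simps)
  then have "m * (J - 2) - J * m / 10 \<le> 2 * (\<Sum>j<J. real (card (good H j)))"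
    using lnK by simp
  moreover have "m * (J - 2) - J * m / 10 \<ge> 4 / 10 * (m * J)"
    using m J by (simp add: of_nat_diff algebra_simps)
  ultimately have good: "2 / 10 * (m * J) \<le> (\<Sum>j<J. real (card (good H j)))" by linarith
  also have "\<dots> \<le> (\<Sum>j<J. real (card (spread j)) + 6 / 100 * m)" by (intro sum_mono spread)
  also have "\<dots> = (\<Sum>j<J. real (card (spread j))) + 6 / 100 * (m * J)" by (simp add: sum.distrib)
  finally have "14 / 100 * (m * J) \<le> (\<Sum>j<J. real (card (spread j)))" by simp
  then have "(14 / 100 * (m * J))\<^sup>2 \<le> (\<Sum>j<J. real (card (spread j)))\<^sup>2"
    using m by (intro power_mono) auto
  also have "\<dots> \<le> 288 * real J * X\<^sup>2" using sum_card_spread_le[of J] unfolding X_def .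
  finally have "real J * ((14 / 100)\<^sup>2 * m\<^sup>2 * J) \<le> real J * (288 * X\<^sup>2)"
    by (simp add: power2_eq_square algebra_simps)
  then have "(14 / 100)\<^sup>2 * m\<^sup>2 * J \<le> 288 * X\<^sup>2" using J by simp
  then have "49 * (m\<^sup>2 * J) \<le> 720000 * X\<^sup>2" by (simp add: power_divide)
  \<comment> \<open>720000 / 49 is below 14884, the square of 122.\<close>
  then have "m\<^sup>2 * J \<le> 14884 * X\<^sup>2" using zero_le_power2[of X] by linarith
  then have "(m * sqrt J)\<^sup>2 \<le> (122 * X)\<^sup>2" by (simp add: power_mult_distrib)
  then show ?thesis unfolding m_def X_def by (rule power2_le_imp_le) simp
qed

end

text \<open>\<open>L\<close> stands for \<open>ln n\<close>. Beyond \<open>1 <= L\<close>, the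
  conditions serve in turn for the lower bound on \<open>ln K\<close>, for
  \<open>2 * |V|^2 <= K * |E|\<close>, for bottom windows that are short compared with the number of
  edges, and for at least four levels.\<close>

lemma eventually_large_enough:
  "\<exists>L0. \<forall>L\<ge>L0. 1 \<le> L \<and> 180 \<le> ln L \<and> 4 * sqrt L \<le> L ^ 21 \<and> 160001 * L ^ 23 \<le> exp (L / 2) \<and> 176 * ln L \<le> (L :: real)"
proof -
  have "eventually (\<lambda>L::real. 1 \<le> L) at_top" "eventually (\<lambda>L::real. 180 \<le> ln L) at_top"
    "eventually (\<lambda>L::real. 4 * sqrt L \<le> L ^ 21) at_top"
    "eventually (\<lambda>L::real. 160001 * L ^ 23 \<le> exp (L / 2)) at_top"
    "eventually (\<lambda>L::real. 176 * ln L \<le> L) at_top"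
    by real_asymp+
  then have "eventually (\<lambda>L::real. 1 \<le> L \<and> 180 \<le> ln L \<and> 4 * sqrt L \<le> L ^ 21 \<and>
      160001 * L ^ 23 \<le> exp (L / 2) \<and> 176 * ln L \<le> L) at_top"
    by eventually_elim auto
  then show ?thesis by (simp add: eventually_at_top_linorder)
qed

text \<open>\<open>K\<close> and \<open>s\<close> are chosen in terms of \<open>n\<close>, so the
  graph is assumed to be pierced for all of them. If there are more than \<open>sqrt L * m\<close>
  piercings, the claim is immediate; otherwise \<open>card_pierces_ge\<close> applies with
  \<open>\<Lambda> = sqrt L\<close>.\<close>

theorem card_pierces_ge_asymptotically:
  "\<exists>n0. \<forall>V E \<tau> P. \<forall>n::nat. n0 \<le> n \<longrightarrow> (\<forall>K s. 0 < K \<longrightarrow> 0 < s \<longrightarrow> pierced_graph V E \<tau> P K s) \<longrightarrow>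
     (\<forall>b u. (b, u) \<in> E \<longrightarrow> \<tau> b u < card E) \<longrightarrow> card V \<le> 2 * n \<longrightarrow>
     2 * (real n)\<^sup>2 \<le> card E * sqrt (ln n) \<longrightarrow>
     card E * sqrt (ln n / ln (ln n)) \<le> 900 * real (card (pierced_graph.pierces (V :: 'v set) P))"
proof -
  obtain L0 where L0: "\<And>L. L0 \<le> L \<Longrightarrow> 1 \<le> L" "\<And>L. L0 \<le> L \<Longrightarrow> 180 \<le> ln L"
    "\<And>L. L0 \<le> L \<Longrightarrow> 4 * sqrt L \<le> L ^ 21" "\<And>L. L0 \<le> L \<Longrightarrow> 160001 * L ^ 23 \<le> exp (L / 2)"
    "\<And>L. L0 \<le> L \<Longrightarrow> 176 * ln L \<le> L"
    using eventually_large_enough by metis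
  define n0 where "n0 = nat \<lceil>exp L0\<rceil>"
  show ?thesis
  proof (intro exI[of _ n0] allI impI)
    fix V :: "'v set" and E \<tau> P and n :: nat
    assume n0: "n0 \<le> n" and pg: "\<forall>K s. 0 < K \<longrightarrow> 0 < s \<longrightarrow> pierced_graph V E \<tau> P K s"
      and \<tau>: "\<forall>b u. (b, u) \<in> E \<longrightarrow> \<tau> b u < card E" and V: "card V \<le> 2 * n"
      and m_ge: "2 * (real n)\<^sup>2 \<le> card E * sqrt (ln n)"
    define L where "L = ln (real n)"
    define X where "X = real (card (pierced_graph.pierces V P))"
    define m where "m = real (card E)"
    have "exp L0 \<le> real n" using n0 unfolding n0_def by linarith
    then have n: "0 < real n" using exp_gt_zero[of L0] by linarith
    have "L0 \<le> L" unfolding L_def using \<open>exp L0 \<le> real n\<close> n by (simp add: ln_ge_iff)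
    note L = L0[OF this]
    have expL: "exp L = n" unfolding L_def using n by simp
    have sq: "1 \<le> sqrt L" using L(1) by simp
    have "0 < m * sqrt L" using m_ge n unfolding m_def L_def by (smt (verit) zero_less_power)
    then have m: "0 < m" using sq by (simp add: zero_less_mult_iff)
    then have E: "E \<noteq> {}" unfolding m_def by auto
    show "card E * sqrt (ln n / ln (ln n)) \<le> 900 * real (card (pierced_graph.pierces V P))"
    proof (cases "X \<le> sqrt L * m")
      case False
      have "sqrt (L / ln L) \<le> sqrt L" using L(1,2) by (intro real_sqrt_le_mono) (simp add: divide_le_eq)
      then have "m * sqrt (L / ln L) \<le> m * sqrt L" using m by (intro mult_left_mono) auto
      also have "\<dots> \<le> X" using False by (simp add: mult.commute)
      finally show ?thesis unfolding m_def L_def X_def by simp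
    next
      case True
      \<comment> \<open>The condition on \<open>ln K\<close> amounts to a constant plus
        \<open>20 * ln L\<close>, hence the exponent 21. In \<open>s\<close>, 160000 is 80000 times
        the factor 2 in \<open>card V <= 2 * n\<close>.\<close>
      define K where "K = nat \<lceil>L ^ 21\<rceil>"
      define s where "s = nat \<lceil>160000 * K * sqrt L * n\<rceil>"
      have L21: "1 \<le> L ^ 21" using L(1) by simp
      have K: "L ^ 21 \<le> real K" "real K \<le> 2 * L ^ 21" unfolding K_def using L21 by linarith+
      have K1: "1 < real K"
      proof -
        have "180 \<le> L - 1" using L(2) ln_le_minus_one[of L] L(1) by linarith
        then have "1 < L" by simp
        then have "1 < L ^ 21" by (intro one_less_power) auto
        then show ?thesis using K(1) by linarith
      qed
      have "0 < 160000 * K * sqrt L * n" using K1 sq n by simp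
      then have s: "160000 * K * sqrt L * n \<le> real s" "real s \<le> 160000 * K * sqrt L * n + 1" "0 < s"
        unfolding s_def by linarith+
      interpret pierced_graph V E \<tau> P K s using pg K1 s(3) by simp
      \<comment> \<open>As \<open>exp (L / 2)\<close> is the square root of \<open>n\<close>, the
        number of bottom windows is at least polynomial in \<open>n\<close>, which yields the number
        of levels.\<close>
      have m_s: "exp (L / 2) * s \<le> m"
      proof -
        have "1 \<le> real n" using n by (simp add: Suc_leI)
        then have "1 \<le> L ^ 22 * n" using mult_mono[of 1 "L ^ 22" 1 "real n"] L(1) by simp
        moreover have "K * sqrt L * n \<le> (2 * L ^ 21) * L * n"
        proof (intro mult_mono)
          have "sqrt L \<le> sqrt (L\<^sup>2)" using L(1) by (intro real_sqrt_le_mono) (simp add: power2_eq_square)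
          then show "sqrt L \<le> L" using L(1) by simp
        qed (use K L in auto)
        ultimately have "real s \<le> 320001 * (L ^ 22 * n)" using s(2) by (simp add: power_Suc2[symmetric] mult.assoc)
        then have "exp (L / 2) * s \<le> exp (L / 2) * (320001 * (L ^ 22 * n))" by (intro mult_left_mono) auto
        also have "\<dots> \<le> 2 * (real n)\<^sup>2 / L"
        proof -
          have "exp (L / 2) * (320001 * (L ^ 22 * n)) * L \<le> exp (L / 2) * ((2 * (160001 * L ^ 23)) * n)"
            using L(1) n by (simp add: power_numeral_reduce mult_ac)
          also have "\<dots> \<le> exp (L / 2) * ((2 * exp (L / 2)) * n)"
            using L(4) n by (intro mult_left_mono mult_right_mono) auto
          also have "\<dots> = 2 * (exp (L / 2) * exp (L / 2)) * n" by simp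
          also have "exp (L / 2) * exp (L / 2) = n" using expL by (simp flip: exp_add)
          finally show ?thesis using L(1) by (simp add: le_divide_eq power2_eq_square mult_ac)
        qed
        also have "\<dots> \<le> m"
        proof -
          have "sqrt L \<le> sqrt (L\<^sup>2)" using L(1) by (intro real_sqrt_le_mono) (simp add: power2_eq_square)
          then have "m * sqrt L \<le> m * L" using m L(1) by (intro mult_left_mono) auto
          then have "2 * (real n)\<^sup>2 \<le> m * L" using m_ge unfolding m_def L_def by linarith
          then show ?thesis using L(1) by (simp add: divide_le_eq)
        qed
        finally show ?thesis .
      qed
      \<comment> \<open>The first level at which one window covers all positions; minimality bounds
        \<open>s * K ^ (J - 1)\<close>.\<close>
      define J where "J = (LEAST J. card E \<le> s * K ^ J)"
      have "\<exists>J. card E \<le> s * K ^ J"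
      proof -
        have "card E < K ^ card E" using K1 by (intro power_gt_expt) simp
        also have "\<dots> \<le> s * K ^ card E" using s(3) by simp
        finally have "card E \<le> s * K ^ card E" by simp
        then show ?thesis ..
      qed
      then have J1: "card E \<le> s * K ^ J" unfolding J_def by (rule LeastI_ex)
      \<comment> \<open>\<open>K ^ J\<close> is at least \<open>exp (L / 2)\<close>, while
        \<open>K\<close> is at most \<open>L ^ 22\<close>.\<close>
      have JL: "L / 44 \<le> J * ln L"
      proof -
        have "exp (L / 2) * s \<le> s * real K ^ J"
          using m_s of_nat_mono[OF J1, where 'a = real] unfolding m_def by simp
        then have "exp (L / 2) \<le> real K ^ J" using s(3) by (simp add: mult.commute)
        also have "\<dots> \<le> (2 * L ^ 21) ^ J" using K K1 by (intro power_mono) auto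
        also have "\<dots> \<le> (L ^ 22) ^ J"
        proof (intro power_mono)
          have "2 \<le> L" using L(2) ln_le_minus_one[of L] L(1) by linarith
          then show "2 * L ^ 21 \<le> L ^ 22" using L(1) by (simp add: power_numeral_reduce)
        qed (use L in auto)
        finally have "L / 2 \<le> ln ((L ^ 22) ^ J)" using L(1) by (subst ln_ge_iff) auto
        also have "\<dots> = J * (22 * ln L)" using L(1) by (simp add: ln_realpow flip: power_mult)
        finally show ?thesis by simp
      qed
      have J4: "4 \<le> J"
      proof -
        have "4 * ln L \<le> J * ln L" using JL L(5) by linarith
        then have "4 \<le> real J" using L(2) by simp
        then show ?thesis by simp
      qed
      have J2: "s * K ^ (J - 1) \<le> card E"
      proof -
        have "\<not> card E \<le> s * K ^ (J - 1)"
          using not_less_Least[of "J - 1" "\<lambda>J. card E \<le> s * K ^ J"] J4 unfolding J_def[symmetric] by simp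
        then show ?thesis by simp
      qed
      have "card E * sqrt J \<le> 122 * real (card pierces)"
      proof (rule card_pierces_ge[OF E _ sq])
        show "real (card pierces) \<le> sqrt L * real (card E)" using True unfolding X_def m_def .
        have "10 * (3 + 2 * ln (200 * sqrt L) + 2 * ln (8 * sqrt L)) = 30 + 20 * (ln 200 + ln 8) + 20 * ln L"
          using L(1) by (simp add: ln_mult ln_sqrt)
        also have "ln 200 + ln 8 = ln (1600 :: real)" using ln_mult_pos[of "200 :: real" 8] by simp
        \<comment> \<open>Then 20 * 15 / 2 and 30 add up to the 180 granted by
          \<open>ln L\<close>.\<close>
        also have "ln (1600 :: real) \<le> 15 / 2"
        proof -
          have "(1600 :: real) ^ 2 \<le> (27182 / 10000) ^ 15" by (simp add: power_divide)
          also have "\<dots> \<le> exp 1 ^ 15" using e_approx_32 by (intro power_mono) (auto simp: abs_if split: if_splits)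
          also have "\<dots> = exp 15" by (simp flip: exp_of_nat_mult)
          finally have "ln ((1600 :: real) ^ 2) \<le> ln (exp 15)" by (subst ln_le_cancel_iff) auto
          moreover have "ln ((1600 :: real) ^ 2) = 2 * ln 1600" by (subst ln_realpow) auto
          ultimately show ?thesis by simp
        qed
        also have "30 + 20 * (15 / 2) + 20 * ln L \<le> 21 * ln L" using L(2) by simp
        also have "\<dots> = ln (L ^ 21)" using L(1) by (simp add: ln_realpow)
        also have "\<dots> \<le> ln K" using K(1) L(1) K1 by (subst ln_le_cancel_iff) auto
        finally show "10 * (3 + 2 * ln (200 * sqrt L) + 2 * ln (8 * sqrt L)) \<le> ln K" by simp
        have "2 * (real (card V))\<^sup>2 \<le> 2 * (2 * real n)\<^sup>2"
          using V by (intro mult_left_mono power_mono) auto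
        also have "\<dots> = 4 * (2 * (real n)\<^sup>2)" by (simp add: power2_eq_square)
        also have "\<dots> \<le> 4 * (m * sqrt L)" using m_ge unfolding m_def L_def by simp
        also have "\<dots> = (4 * sqrt L) * m" by simp
        also have "\<dots> \<le> K * m" using L(3) K(1) m by (intro mult_right_mono) auto
        finally show "2 * (real (card V))\<^sup>2 \<le> real (K * card E)" unfolding m_def by simp
        have "80000 * K * sqrt L * card V \<le> 80000 * K * sqrt L * (2 * n)"
          using V sq by (intro mult_left_mono) auto
        also have "\<dots> \<le> s" using s(1) by simp
        finally show "real (80000 * K) * sqrt L * real (card V) \<le> real s" by simp
      qed (use \<tau> J1 J2 J4 in auto)
      \<comment> \<open>44 is rounded up to the square 49; then 122 * 7 is below 900.\<close>
      moreover have "sqrt (L / ln L) \<le> 7 * sqrt J"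
      proof -
        have "0 \<le> J * ln L" using L(2) by simp
        then have "L \<le> 49 * (J * ln L)" using JL by linarith
        then have "L / ln L \<le> 49 * J" using L(2) by (simp add: divide_le_eq mult.assoc)
        then have "sqrt (L / ln L) \<le> sqrt (49 * J)" by (rule real_sqrt_le_mono)
        also have "sqrt (49 * J) = 7 * sqrt J" by (simp add: real_sqrt_mult real_sqrt_unique[of 7 49])
        finally show ?thesis .
      qed
      then have "m * sqrt (L / ln L) \<le> m * (7 * sqrt J)" using m by (intro mult_left_mono) auto
      ultimately have "m * sqrt (L / ln L) \<le> 900 * X"
        unfolding X_def m_def by (simp add: mult_ac)
      then show ?thesis unfolding m_def L_def X_def .
    qed
  qed
qed

section \<open>Monotone curves\<close>

definition height :: "(real \<times> real) set \<Rightarrow> real \<Rightarrow> real" where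
  "height A x = (THE y. (x, y) \<in> A)"

text \<open>Weak, so that it can hold for curves that touch.\<close>

definition above :: "(real \<times> real) set \<Rightarrow> (real \<times> real) set \<Rightarrow> bool" where
  "above A B \<longleftrightarrow> (\<forall>x\<in>fst ` A \<inter> fst ` B. height B x \<le> height A x)"

lemma x_monotone_curve_iff_height:
  assumes "x_monotone_curve A"
  shows "(x, y) \<in> A \<longleftrightarrow> x \<in> fst ` A \<and> y = height A x"
proof -
  have eq: "height A x = y" if "(x, y) \<in> A" for x y
    unfolding height_def
  proof (rule the_equality)
    fix y' assume "(x, y') \<in> A"
    then show "y' = y" using assms that unfolding x_monotone_curve_def inj_on_def by force
  qed (rule that)
  then show ?thesis by force
qed

text \<open>The first coordinate is a continuous injection of the parameter interval into the line,
  hence a homeomorphism onto its image; the height is the second coordinate of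
  \<open>\<gamma>\<close> after its inverse.\<close>

lemma x_monotone_curve_interval:
  assumes "x_monotone_curve A"
  shows "is_interval (fst ` A)" and "continuous_on (fst ` A) (height A)"
proof -
  obtain I :: "real set" and \<gamma> where I: "is_interval I" "continuous_on I \<gamma>" "inj_on \<gamma> I" and A: "A = \<gamma> ` I"
    using assms unfolding x_monotone_curve_def curve_def by blast
  have f: "continuous_on I (\<lambda>t. fst (\<gamma> t))" using I(2) by (intro continuous_intros)
  have im: "(\<lambda>t. fst (\<gamma> t)) ` I = fst ` A" unfolding A by (simp add: image_image)
  have inj: "inj_on (\<lambda>t. fst (\<gamma> t)) I"
    using assms I(3) unfolding x_monotone_curve_def A by (auto simp: inj_on_def)
  have "path_connected I" using I(1) by (simp add: is_interval_path_connected)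
  then obtain g where g: "homeomorphism I (fst ` A) (\<lambda>t. fst (\<gamma> t)) g"
    using homeomorphism_into_1d[OF _ f im inj] by blast
  have "connected (fst ` A)"
    using connected_continuous_image[OF f] I(1) im by (simp add: is_interval_connected_1)
  then show "is_interval (fst ` A)" by (simp add: is_interval_connected_1)
  have "height A x = snd (\<gamma> (g x))" if x: "x \<in> fst ` A" for x
  proof -
    have "g x \<in> I" "fst (\<gamma> (g x)) = x" using g x unfolding homeomorphism_def by auto
    then have "(x, snd (\<gamma> (g x))) \<in> A" unfolding A by (metis image_eqI prod.collapse)
    then show ?thesis using x_monotone_curve_iff_height[OF assms] by simp
  qed
  moreover have "continuous_on (fst ` A) (\<lambda>x. snd (\<gamma> (g x)))"
  proof -
    have "continuous_on (fst ` A) g" "g ` fst ` A = I" using g unfolding homeomorphism_def by auto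
    then have "continuous_on (fst ` A) (\<lambda>x. \<gamma> (g x))" using I(2) continuous_on_compose2 by blast
    then show ?thesis by (rule continuous_on_snd)
  qed
  ultimately show "continuous_on (fst ` A) (height A)" using continuous_on_cong by force
qed

lemma interval_contains_Icc:
  fixes D :: "real set"
  assumes "is_interval D" "a \<in> D" "b \<in> D"
  shows "{a..b} \<subseteq> D"
  using mem_is_interval_1_I[OF assms] by auto

section \<open>Crossings forced by a change of order\<close>

lemma properly_cross_at_sym: "properly_cross_at A B p \<longleftrightarrow> properly_cross_at B A p"
  unfolding properly_cross_at_def by blast

lemma touching_point_sym: "touching_point A B p \<longleftrightarrow> touching_point B A p"
  unfolding touching_point_def using properly_cross_at_sym by (simp add: Int_commute)

text \<open>The difference of the heights has a zero by the intermediate value theorem, and only at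
  the single common point. So it keeps its sign on each side of that point.\<close>

lemma properly_cross_at_of_order_change:
  assumes "x_monotone_curve A" "x_monotone_curve B" "A \<inter> B = {p}"
    and sub: "{x1..x2} \<subseteq> fst ` A \<inter> fst ` B"
    and x1: "x1 \<le> x2" "height A x1 < height B x1" and x2: "height B x2 < height A x2"
  shows "properly_cross_at A B p \<and> x1 < fst p \<and> fst p < x2"
proof -
  note grA = x_monotone_curve_iff_height[OF assms(1)] and grB = x_monotone_curve_iff_height[OF assms(2)]
  let ?h = "\<lambda>x. height B x - height A x"
  have cont: "continuous_on {x1..x2} ?h"
    using sub by (intro continuous_on_diff continuous_on_subset[OF x_monotone_curve_interval(2)[OF assms(1)]]
        continuous_on_subset[OF x_monotone_curve_interval(2)[OF assms(2)]]) auto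
  have zero: "x = fst p" if "x \<in> {x1..x2}" "?h x = 0" for x
  proof -
    have "x \<in> fst ` A" "x \<in> fst ` B" using that(1) sub by auto
    then have "(x, height A x) \<in> A \<inter> B" using that(2) grA[of x "height A x"] grB[of x "height A x"] by simp
    then have "p = (x, height A x)" using assms(3) by simp
    then show ?thesis by simp
  qed
  obtain z where z: "x1 \<le> z" "z \<le> x2" "?h z = 0"
    using IVT2'[of ?h x2 0 x1] cont x1 x2 by auto
  have zp: "z = fst p" using zero z by simp
  have zx: "x1 < z" "z < x2" using z x1 x2 by (auto simp: le_less)
  have left: "0 < ?h x" if x: "x1 \<le> x" "x < z" for x
  proof (rule ccontr)
    assume "\<not> 0 < ?h x"
    then obtain w where "x1 \<le> w" "w \<le> x" "?h w = 0"
      using IVT2'[of ?h x 0 x1] x x1 zx continuous_on_subset[OF cont, of "{x1..x}"] by auto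
    then show False using zero[of w] zp x zx by auto
  qed
  have right: "?h x < 0" if x: "z < x" "x \<le> x2" for x
  proof (rule ccontr)
    assume "\<not> ?h x < 0"
    then obtain w where "x \<le> w" "w \<le> x2" "?h w = 0"
      using IVT2'[of ?h x2 0 x] x x2 zx continuous_on_subset[OF cont, of "{x..x2}"] by auto
    then show False using zero[of w] zp x zx by auto
  qed
  define d where "d = min (z - x1) (x2 - z)"
  have d: "0 < d" "d \<le> z - x1" "d \<le> x2 - z" using zx unfolding d_def by auto
  have mem: "(x, height A x) \<in> A" "(x, height B x) \<in> B" if "x \<in> {x1..x2}" for x
    using that sub grA[of x "height A x"] grB[of x "height B x"] by auto
  have "\<forall>x\<in>{fst p - d<..<fst p}. below_at A B x"
  proof
    fix x assume "x \<in> {fst p - d<..<fst p}"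
    then have "x1 \<le> x" "x < z" "x \<in> {x1..x2}" using d zx unfolding zp[symmetric] by auto
    then show "below_at A B x" unfolding below_at_def using mem left[of x] by fastforce
  qed
  moreover have "\<forall>x\<in>{fst p<..<fst p + d}. below_at B A x"
  proof
    fix x assume "x \<in> {fst p<..<fst p + d}"
    then have "z < x" "x \<le> x2" "x \<in> {x1..x2}" using d zx unfolding zp[symmetric] by auto
    then show "below_at B A x" unfolding below_at_def using mem right[of x] by fastforce
  qed
  moreover have "p \<in> A \<inter> B" using assms(3) by simp
  ultimately have "properly_cross_at A B p"
    unfolding properly_cross_at_def using d(1) by blast
  then show ?thesis using zx zp by simp
qed

text \<open>Were the common point found between \<open>x1\<close> and \<open>x2\<close> a touching
  point, it would be the only common point, and then a proper crossing by the previous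
  lemma.\<close>

lemma crossing_of_order_change:
  assumes "x_monotone_curve A" "x_monotone_curve B"
    and sub: "{x1..x2} \<subseteq> fst ` A \<inter> fst ` B"
    and x1: "x1 \<le> x2" "height A x1 < height B x1" and x2: "height B x2 < height A x2"
  shows "\<exists>p\<in>A \<inter> B. \<not> touching_point A B p \<and> x1 < fst p \<and> fst p < x2"
proof -
  note grA = x_monotone_curve_iff_height[OF assms(1)] and grB = x_monotone_curve_iff_height[OF assms(2)]
  let ?h = "\<lambda>x. height B x - height A x"
  have cont: "continuous_on {x1..x2} ?h"
    using sub by (intro continuous_on_diff continuous_on_subset[OF x_monotone_curve_interval(2)[OF assms(1)]]
        continuous_on_subset[OF x_monotone_curve_interval(2)[OF assms(2)]]) auto
  obtain z where z: "x1 \<le> z" "z \<le> x2" "?h z = 0"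
    using IVT2'[of ?h x2 0 x1] cont x1 x2 by auto
  have zx: "x1 < z" "z < x2" using z x1 x2 by (auto simp: le_less)
  let ?p = "(z, height A z)"
  have "z \<in> fst ` A" "z \<in> fst ` B" using z sub by auto
  then have p: "?p \<in> A \<inter> B" using z(3) grA[of z "height A z"] grB[of z "height A z"] by simp
  moreover have "\<not> touching_point A B ?p"
    using properly_cross_at_of_order_change[OF assms(1,2) _ sub x1 x2] unfolding touching_point_def by blast
  ultimately show ?thesis using zx by (intro bexI[of _ ?p]) auto
qed

text \<open>If both strict orders occurred, the order would change on the common x-range, which is
  an interval, and the touching point would be a proper crossing.\<close>

lemma touch_imp_above:
  assumes A: "x_monotone_curve A" and B: "x_monotone_curve B" and "touch A B"
  shows "above A B \<or> above B A"
proof (rule ccontr)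
  assume "\<not> ?thesis"
  then obtain x x' where x: "x \<in> fst ` A \<inter> fst ` B" "height A x < height B x"
    and x': "x' \<in> fst ` A \<inter> fst ` B" "height B x' < height A x'"
    unfolding above_def by (auto simp: not_le)
  obtain p where p: "A \<inter> B = {p}" "\<not> properly_cross_at A B p"
    using assms(3) unfolding touch_def touching_point_def by blast
  have I: "is_interval (fst ` A \<inter> fst ` B)"
    using x_monotone_curve_interval(1)[OF A] x_monotone_curve_interval(1)[OF B] by (rule is_interval_Int)
  consider "x \<le> x'" | "x' \<le> x" by linarith
  then show False
  proof cases
    case 1
    then show False
      using properly_cross_at_of_order_change[OF A B p(1) interval_contains_Icc[OF I x(1) x'(1)] _ x(2) x'(2)] p(2)
      by blast
  next
    case 2
    have "B \<inter> A = {p}" "{x'..x} \<subseteq> fst ` B \<inter> fst ` A"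
      using p(1) interval_contains_Icc[OF I x'(1) x(1)] by auto
    from properly_cross_at_of_order_change[OF B A this 2 x'(2) x(2)] p(2)
    show False using properly_cross_at_sym by blast
  qed
qed

text \<open>Distinct touchings may have the same x-coordinate, so ties are broken arbitrarily. The
  induction gives the last rank to an element of largest coordinate.\<close>

lemma monotone_rank_exists:
  fixes x :: "'e \<Rightarrow> real"
  assumes "finite F"
  shows "\<exists>r. bij_betw r F {..<card F} \<and> (\<forall>e\<in>F. \<forall>e'\<in>F. x e < x e' \<longrightarrow> r e < r e')"
  using assms
proof (induction "card F" arbitrary: F)
  case 0
  then show ?case by (auto simp: bij_betw_def)
next
  case (Suc k)
  then have ne: "F \<noteq> {}" by auto
  then have "Max (x ` F) \<in> x ` F" using Suc.prems by (intro Max_in) auto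
  then obtain e where e: "e \<in> F" "x e = Max (x ` F)" by (metis imageE)
  have max: "x e' \<le> x e" if "e' \<in> F" for e' using that e Suc.prems by simp
  have k: "card (F - {e}) = k" using Suc e by simp
  then obtain r where r: "bij_betw r (F - {e}) {..<k}" "\<forall>a\<in>F - {e}. \<forall>b\<in>F - {e}. x a < x b \<longrightarrow> r a < r b"
    using Suc.hyps(1)[of "F - {e}"] Suc.prems by auto
  define r' where "r' = r(e := k)"
  have rlt: "r a < k" if "a \<in> F - {e}" for a using r(1) that unfolding bij_betw_def by auto
  have "r' ` F = insert k (r ` (F - {e}))" unfolding r'_def using e(1) by auto
  then have im: "r' ` F = {..<card F}"
    using r(1) Suc.hyps(2)[symmetric] unfolding bij_betw_def by (simp add: lessThan_Suc)
  then have "inj_on r' F" using Suc.prems by (intro eq_card_imp_inj_on) simp_all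
  with im have "bij_betw r' F {..<card F}" unfolding bij_betw_def by simp
  moreover have "\<forall>a\<in>F. \<forall>b\<in>F. x a < x b \<longrightarrow> r' a < r' b"
  proof (intro ballI impI)
    fix a b assume ab: "a \<in> F" "b \<in> F" "x a < x b"
    then have "a \<noteq> e" using max by force
    then show "r' a < r' b" using ab r(2) rlt unfolding r'_def by auto
  qed
  ultimately show ?case by blast
qed

text \<open>The elements to the left of \<open>q\<close> occupy an initial segment of the ranks, so
  their number is the position of \<open>q\<close> among the ranks.\<close>

lemma rank_less_card_below:
  fixes x :: "'e \<Rightarrow> real"
  assumes "finite F" "bij_betw r F {..<card F}" "\<forall>e\<in>F. \<forall>e'\<in>F. x e < x e' \<longrightarrow> r e < r e'" "e \<in> F"
  shows "x e < q \<Longrightarrow> r e < card {e \<in> F. x e < q}" and "q \<le> x e \<Longrightarrow> card {e \<in> F. x e < q} \<le> r e"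
proof -
  let ?B = "{e \<in> F. x e < q}"
  have inj: "inj_on r ?B" using assms(2) unfolding bij_betw_def inj_on_def by auto
  have card: "card (r ` ?B) = card ?B" by (rule card_image[OF inj])
  show "r e < card ?B" if "x e < q"
  proof -
    have "{..r e} \<subseteq> r ` ?B"
    proof
      fix i assume i: "i \<in> {..r e}"
      have "r e < card F" using assms(2,4) unfolding bij_betw_def by auto
      then have "i \<in> r ` F" using i assms(2) unfolding bij_betw_def by auto
      then obtain e' where e': "e' \<in> F" "r e' = i" by auto
      then have "\<not> x e < x e'" using assms(3,4) i by fastforce
      then show "i \<in> r ` ?B" using e' that by auto
    qed
    then have "card {..r e} \<le> card (r ` ?B)" using assms(1) by (intro card_mono) auto
    then show ?thesis using card by simp
  qed
  show "card ?B \<le> r e" if "q \<le> x e"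
  proof -
    have "r ` ?B \<subseteq> {..<r e}" using assms(3,4) that by force
    then have "card (r ` ?B) \<le> card {..<r e}" by (intro card_mono) auto
    then show ?thesis using card by simp
  qed
qed

section \<open>The pierced graph of a family of curves\<close>

locale curve_family =
  fixes S :: "(real \<times> real) set set"
  assumes finite_S: "finite S" and x_monotone: "A \<in> S \<Longrightarrow> x_monotone_curve A"
    and general_position: "general_position S"
begin

definition touch_x :: "(real \<times> real) set \<Rightarrow> (real \<times> real) set \<Rightarrow> real" where
  "touch_x A B = fst (the_elem (A \<inter> B))"

definition touchings :: "((real \<times> real) set \<times> (real \<times> real) set) set" where
  "touchings = {(A, B). A \<in> S \<and> B \<in> S \<and> A \<noteq> B \<and> touch A B \<and> above A B}"

definition rank :: "(real \<times> real) set \<times> (real \<times> real) set \<Rightarrow> nat" where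
  "rank = (SOME r. bij_betw r touchings {..<card touchings} \<and>
     (\<forall>e\<in>touchings. \<forall>e'\<in>touchings. case_prod touch_x e < case_prod touch_x e' \<longrightarrow> r e < r e'))"

text \<open>The strict inequality fits the half-open condition of \<open>pierce\<close>: a touching
  exactly at \<open>q\<close> has a rank of at least \<open>pos q\<close>.\<close>

definition pos :: "real \<Rightarrow> nat" where
  "pos q = card {e \<in> touchings. case_prod touch_x e < q}"

text \<open>The flag \<open>True\<close> marks the upper copy of a curve.\<close>

definition V :: "((real \<times> real) set \<times> bool) set" where
  "V = S \<times> UNIV"

definition E :: "(((real \<times> real) set \<times> bool) \<times> ((real \<times> real) set \<times> bool)) set" where
  "E = {(a, b). snd a \<noteq> snd b \<and> (if snd a then (fst a, fst b) else (fst b, fst a)) \<in> touchings}"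

text \<open>The value 0 for copies with equal flags is a default; such copies are never
  adjacent.\<close>

definition \<tau> :: "(real \<times> real) set \<times> bool \<Rightarrow> (real \<times> real) set \<times> bool \<Rightarrow> nat" where
  "\<tau> a b = (if snd a = snd b then 0 else rank (if snd a then (fst a, fst b) else (fst b, fst a)))"

definition crossings :: "(real \<times> real) set \<Rightarrow> (real \<times> real) set \<Rightarrow> (real \<times> real) set" where
  "crossings A B = {p \<in> A \<inter> B. \<not> touching_point A B p}"

text \<open>
  A curve that ends between two touchings need not cross there; the position of its first touching,
  or the one after its last touching, then serves as a substitute.
\<close>

definition ends :: "(real \<times> real) set \<times> bool \<Rightarrow> nat set" where
  "ends a = {Min (\<tau> a ` {u. (a, u) \<in> E}), Suc (Max (\<tau> a ` {u. (a, u) \<in> E}))}"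

text \<open>Distinct neighbours of one vertex are copies of different curves with the same flag;
  these are the pairs that \<open>pierce\<close> speaks of.\<close>

definition P :: "(real \<times> real) set \<times> bool \<Rightarrow> (real \<times> real) set \<times> bool \<Rightarrow> nat set" where
  "P a b = (if a \<in> V \<and> b \<in> V \<and> snd a = snd b \<and> fst a \<noteq> fst b
     then pos ` fst ` crossings (fst a) (fst b) \<union> ends a \<union> ends b else {})"

lemma finite_touchings: "finite touchings"
  by (rule finite_subset[of _ "S \<times> S"]) (auto simp: touchings_def finite_S)

lemma rank: "bij_betw rank touchings {..<card touchings}"
    "\<forall>e\<in>touchings. \<forall>e'\<in>touchings. case_prod touch_x e < case_prod touch_x e' \<longrightarrow> rank e < rank e'"
  using someI_ex[OF monotone_rank_exists[OF finite_touchings, of "case_prod touch_x"]] unfolding rank_def by blast+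

lemma E_sym: "(a, u) \<in> E \<Longrightarrow> (u, a) \<in> E"
  unfolding E_def by auto

lemma \<tau>_sym: "\<tau> a u = \<tau> u a"
  unfolding \<tau>_def by auto

lemma touch_x_sym: "touch_x A B = touch_x B A"
  unfolding touch_x_def by (simp add: Int_commute)

lemma touch_sym: "touch A B \<longleftrightarrow> touch B A"
  unfolding touch_def using touching_point_sym by blast

lemma edgeD:
  assumes "(a, u) \<in> E"
  shows "fst a \<in> S" "fst u \<in> S" "fst a \<noteq> fst u" "snd u \<longleftrightarrow> \<not> snd a"
    "touch_x (fst a) (fst u) \<in> fst ` fst a" "touch_x (fst a) (fst u) \<in> fst ` fst u"
    "height (fst a) (touch_x (fst a) (fst u)) = height (fst u) (touch_x (fst a) (fst u))"
    "if snd a then above (fst a) (fst u) else above (fst u) (fst a)"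
proof -
  show *: "fst a \<in> S" "fst u \<in> S" "fst a \<noteq> fst u" "snd u \<longleftrightarrow> \<not> snd a"
    "if snd a then above (fst a) (fst u) else above (fst u) (fst a)"
    using assms unfolding E_def touchings_def by (auto split: if_splits)
  have "touch (fst a) (fst u)" using assms touch_sym unfolding E_def touchings_def by (auto split: if_splits)
  then obtain x y where p: "fst a \<inter> fst u = {(x, y)}" unfolding touch_def touching_point_def by auto
  then have x: "touch_x (fst a) (fst u) = x" unfolding touch_x_def by simp
  have "(x, y) \<in> fst a" "(x, y) \<in> fst u" using p by auto
  then show "touch_x (fst a) (fst u) \<in> fst ` fst a" "touch_x (fst a) (fst u) \<in> fst ` fst u"
    "height (fst a) (touch_x (fst a) (fst u)) = height (fst u) (touch_x (fst a) (fst u))"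
    unfolding x using x_monotone_curve_iff_height[OF x_monotone[OF *(1)]] x_monotone_curve_iff_height[OF x_monotone[OF *(2)]]
    by auto
qed

lemma edge_touching:
  assumes "(a, u) \<in> E"
  obtains e where "e \<in> touchings" "\<tau> a u = rank e" "touch_x (fst a) (fst u) = case_prod touch_x e"
    "e = (if snd a then (fst a, fst u) else (fst u, fst a))"
proof -
  let ?e = "if snd a then (fst a, fst u) else (fst u, fst a)"
  have "?e \<in> touchings" "\<tau> a u = rank ?e" "touch_x (fst a) (fst u) = case_prod touch_x ?e"
    using assms touch_x_sym unfolding E_def \<tau>_def by auto
  then show ?thesis using that by blast
qed

lemma \<tau>_less:
  assumes "(a, u) \<in> E" "(b, v) \<in> E" "touch_x (fst a) (fst u) < touch_x (fst b) (fst v)"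
  shows "\<tau> a u < \<tau> b v"
proof -
  obtain e where e: "e \<in> touchings" "\<tau> a u = rank e" "touch_x (fst a) (fst u) = case_prod touch_x e"
    by (rule edge_touching[OF assms(1)])
  obtain e' where e': "e' \<in> touchings" "\<tau> b v = rank e'" "touch_x (fst b) (fst v) = case_prod touch_x e'"
    by (rule edge_touching[OF assms(2)])
  show ?thesis using rank(2) e e' assms(3) by simp
qed

lemma \<tau>_pos:
  assumes "(a, u) \<in> E"
  shows "touch_x (fst a) (fst u) < q \<Longrightarrow> \<tau> a u < pos q" "q \<le> touch_x (fst a) (fst u) \<Longrightarrow> pos q \<le> \<tau> a u"
proof -
  obtain e where e: "e \<in> touchings" "\<tau> a u = rank e" "touch_x (fst a) (fst u) = case_prod touch_x e"
    by (rule edge_touching[OF assms])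
  show "touch_x (fst a) (fst u) < q \<Longrightarrow> \<tau> a u < pos q" "q \<le> touch_x (fst a) (fst u) \<Longrightarrow> pos q \<le> \<tau> a u"
    using rank_less_card_below[OF finite_touchings rank e(1)] unfolding e pos_def by auto
qed

text \<open>The rank determines the touching, and the flags tell its upper copy from its lower one,
  so only the direction of the edge remains open.\<close>

lemma \<tau>_inj:
  assumes "(a, u) \<in> E" "(b, v) \<in> E" "\<tau> a u = \<tau> b v"
  shows "a = b \<and> u = v \<or> a = v \<and> u = b"
proof -
  obtain e where e: "e \<in> touchings" "\<tau> a u = rank e" "e = (if snd a then (fst a, fst u) else (fst u, fst a))"
    by (rule edge_touching[OF assms(1)])
  obtain e' where e': "e' \<in> touchings" "\<tau> b v = rank e'" "e' = (if snd b then (fst b, fst v) else (fst v, fst b))"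
    by (rule edge_touching[OF assms(2)])
  have "e = e'" using rank(1) e(1,2) e'(1,2) assms(3) unfolding bij_betw_def inj_on_def by auto
  then show ?thesis
    using e(3) e'(3) edgeD(4)[OF assms(1)] edgeD(4)[OF assms(2)] by (auto simp: prod_eq_iff split: if_splits)
qed

lemma \<tau>_less_card: "(a, u) \<in> E \<Longrightarrow> \<tau> a u < card touchings"
  using rank(1) unfolding E_def \<tau>_def bij_betw_def by (auto split: if_splits)

lemma finite_crossings:
  assumes "A \<in> S" "B \<in> S" "A \<noteq> B"
  shows "finite (crossings A B)"
proof -
  have "finite (A \<inter> B)" using conjunct2[OF general_position[unfolded general_position_def]] assms by simp
  then show ?thesis unfolding crossings_def by (rule rev_finite_subset) blast
qed

lemma crossings_sym: "crossings A B = crossings B A"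
  unfolding crossings_def using touching_point_sym by (auto simp: Int_commute)

lemma E_subset: "E \<subseteq> V \<times> V"
  unfolding E_def V_def touchings_def by (auto split: if_splits simp: mem_Times_iff)

lemma finite_V: "finite V"
  unfolding V_def using finite_S by simp

text \<open>If all edges at \<open>u\<close> precede \<open>\<tau> a v\<close>, the successor of the
  last one fits; if all edges at \<open>v\<close> follow \<open>\<tau> a u\<close>, the first one
  fits. The \<open>Suc\<close> in \<open>ends\<close> is due to the strict inequality on the
  left.\<close>

lemma ends_between:
  assumes e: "(a, u) \<in> E" "(a, v) \<in> E"
  shows "(\<And>b. (u, b) \<in> E \<Longrightarrow> \<tau> u b < \<tau> a v) \<Longrightarrow> \<exists>p\<in>ends u. \<tau> a u < p \<and> p \<le> \<tau> a v"
    and "(\<And>b. (v, b) \<in> E \<Longrightarrow> \<tau> a u < \<tau> v b) \<Longrightarrow> \<exists>p\<in>ends v. \<tau> a u < p \<and> p \<le> \<tau> a v"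
proof -
  have fin: "finite (\<tau> w ` {b. (w, b) \<in> E})" for w
    using E_subset finite_V by (intro finite_imageI) (auto intro: finite_subset[of _ V])
  have u: "\<tau> a u \<in> \<tau> u ` {b. (u, b) \<in> E}" using E_sym[OF e(1)] \<tau>_sym[of a u] by auto
  have v: "\<tau> a v \<in> \<tau> v ` {b. (v, b) \<in> E}" using E_sym[OF e(2)] \<tau>_sym[of a v] by auto
  show "\<exists>p\<in>ends u. \<tau> a u < p \<and> p \<le> \<tau> a v" if "\<And>b. (u, b) \<in> E \<Longrightarrow> \<tau> u b < \<tau> a v"
  proof -
    have "Max (\<tau> u ` {b. (u, b) \<in> E}) < \<tau> a v" using that u fin[of u] by (subst Max_less_iff) auto
    moreover have "\<tau> a u \<le> Max (\<tau> u ` {b. (u, b) \<in> E})" using u fin[of u] by simp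
    ultimately show ?thesis unfolding ends_def by auto
  qed
  show "\<exists>p\<in>ends v. \<tau> a u < p \<and> p \<le> \<tau> a v" if "\<And>b. (v, b) \<in> E \<Longrightarrow> \<tau> a u < \<tau> v b"
  proof -
    have "\<tau> a u < Min (\<tau> v ` {b. (v, b) \<in> E})" using that v fin[of v] by (subst Min_gr_iff) auto
    moreover have "Min (\<tau> v ` {b. (v, b) \<in> E}) \<le> \<tau> a v" using v fin[of v] by simp
    ultimately show ?thesis unfolding ends_def by auto
  qed
qed

text \<open>\<open>u\<close> meets \<open>a\<close> at this x-coordinate, and \<open>v\<close> lies
  weakly on the same side of \<open>a\<close>. No three curves share a point, so \<open>v\<close> is
  strictly farther away.\<close>

lemma order_at_touching:
  assumes e: "(a, u) \<in> E" "(a, v) \<in> E" "u \<noteq> v" and x: "touch_x (fst a) (fst u) \<in> fst ` fst v"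
  shows "if snd a then height (fst v) (touch_x (fst a) (fst u)) < height (fst u) (touch_x (fst a) (fst u))
    else height (fst u) (touch_x (fst a) (fst u)) < height (fst v) (touch_x (fst a) (fst u))"
proof -
  let ?x = "touch_x (fst a) (fst u)" and ?A = "fst a" and ?U = "fst u" and ?W = "fst v"
  note u = edgeD[OF e(1)] and v = edgeD[OF e(2)]
  have ne: "?U \<noteq> ?W" using e(3) u(4) v(4) by (auto simp: prod_eq_iff)
  have "height ?W ?x \<noteq> height ?U ?x"
  proof
    assume eq: "height ?W ?x = height ?U ?x"
    let ?p = "(?x, height ?U ?x)"
    have "?p \<in> ?A" "?p \<in> ?U" "?p \<in> ?W"
      using u(5-7) x eq x_monotone_curve_iff_height[OF x_monotone[OF u(1)]]
        x_monotone_curve_iff_height[OF x_monotone[OF u(2)]] x_monotone_curve_iff_height[OF x_monotone[OF v(2)]]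
      by auto
    moreover have "?A \<inter> ?U \<inter> ?W = {}"
      using general_position u(1-3) v(2,3) ne unfolding general_position_def by blast
    ultimately show False by blast
  qed
  moreover have "if snd a then height ?W ?x \<le> height ?A ?x else height ?A ?x \<le> height ?W ?x"
    using v(8) u(5) x unfolding above_def by auto
  ultimately show ?thesis using u(7) by (auto split: if_splits)
qed

text \<open>If both curves extend over the x-range between the two touchings,
  \<open>order_at_touching\<close> gives opposite orders at its ends and hence a crossing. Otherwise
  one x-range misses some \<open>z\<close>; being an interval, it lies left of \<open>z\<close> in
  the case of \<open>u\<close> and right of \<open>z\<close> in the case of
  \<open>v\<close>.\<close>

lemma pierce:
  assumes e: "(a, u) \<in> E" "(a, v) \<in> E" "u \<noteq> v" and lt: "\<tau> a u < \<tau> a v"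
  shows "\<exists>p\<in>P u v. \<tau> a u < p \<and> p \<le> \<tau> a v"
proof -
  let ?A = "fst a" and ?U = "fst u" and ?W = "fst v"
  let ?x1 = "touch_x ?A ?U" and ?x2 = "touch_x ?A ?W"
  note u = edgeD[OF e(1)] and v = edgeD[OF e(2)]
  note monU = x_monotone[OF u(2)] and monW = x_monotone[OF v(2)]
  have ne: "?U \<noteq> ?W" using e(3) u(4) v(4) by (auto simp: prod_eq_iff)
  have P: "P u v = pos ` fst ` crossings ?U ?W \<union> ends u \<union> ends v"
    unfolding P_def using ne u(2,4) v(2,4) by (simp add: V_def mem_Times_iff)
  have le: "?x1 \<le> ?x2" using \<tau>_less[OF e(2,1)] lt by force
  consider "{?x1..?x2} \<subseteq> fst ` ?U \<inter> fst ` ?W" | z where "z \<in> {?x1..?x2}" "z \<notin> fst ` ?U"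
    | z where "z \<in> {?x1..?x2}" "z \<notin> fst ` ?W" by blast
  then show ?thesis
  proof cases
    case 1
    then have "?x1 \<in> fst ` ?W" "?x2 \<in> fst ` ?U" using le by auto
    note o = order_at_touching[OF e this(1)] order_at_touching[OF e(2,1) e(3)[symmetric] this(2)]
    have "\<exists>p\<in>crossings ?U ?W. ?x1 < fst p \<and> fst p < ?x2"
    proof (cases "snd a")
      case True
      then have "\<exists>p\<in>?W \<inter> ?U. \<not> touching_point ?W ?U p \<and> ?x1 < fst p \<and> fst p < ?x2"
        using 1 o by (intro crossing_of_order_change[OF monW monU _ le]) auto
      then show ?thesis unfolding crossings_sym[of ?U ?W] unfolding crossings_def by blast
    next
      case False
      then have "\<exists>p\<in>?U \<inter> ?W. \<not> touching_point ?U ?W p \<and> ?x1 < fst p \<and> fst p < ?x2"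
        using 1 o by (intro crossing_of_order_change[OF monU monW _ le]) auto
      then show ?thesis unfolding crossings_def by blast
    qed
    then obtain p where "p \<in> crossings ?U ?W" "?x1 < fst p" "fst p < ?x2" by blast
    then show ?thesis unfolding P using \<tau>_pos(1)[OF e(1)] \<tau>_pos(2)[OF e(2)]
      by (intro bexI[of _ "pos (fst p)"]) auto
  next
    case (2 z)
    have "\<tau> u b < \<tau> a v" if b: "(u, b) \<in> E" for b
    proof -
      have "touch_x ?U (fst b) \<in> fst ` ?U" using edgeD(5)[OF b] .
      then have "\<not> z \<le> touch_x ?U (fst b)"
        using interval_contains_Icc[OF x_monotone_curve_interval(1)[OF monU] u(6)] 2 by force
      then show ?thesis using 2 \<tau>_less[OF b e(2)] by auto
    qed
    then show ?thesis unfolding P using ends_between(1)[OF e(1,2)] by blast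
  next
    case (3 z)
    have "\<tau> a u < \<tau> v b" if b: "(v, b) \<in> E" for b
    proof -
      have "touch_x ?W (fst b) \<in> fst ` ?W" using edgeD(5)[OF b] .
      then have "\<not> touch_x ?W (fst b) \<le> z"
        using interval_contains_Icc[OF x_monotone_curve_interval(1)[OF monW] _ v(6)] 3 by force
      then show ?thesis using 3 \<tau>_less[OF e(1) b] by auto
    qed
    then show ?thesis unfolding P using ends_between(2)[OF e(1,2)] by blast
  qed
qed

lemma finite_P: "finite (P a b)"
  unfolding P_def V_def ends_def using finite_crossings by (auto simp: mem_Times_iff)

lemma P_sym: "P a b = P b a"
  unfolding P_def using crossings_sym[of "fst a" "fst b"] by auto

lemma pierced_graph: "0 < K \<Longrightarrow> 0 < s \<Longrightarrow> pierced_graph V E \<tau> P K s"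
  using finite_V E_subset E_sym \<tau>_sym \<tau>_inj finite_P P_sym pierce by unfold_locales

section \<open>Counting edges, crossings and piercings\<close>

lemma card_E: "card E = 2 * card touchings"
proof -
  let ?f = "\<lambda>(A, B). ((A, True), (B, False))" and ?g = "\<lambda>(A, B). ((B, False), (A, True))"
  have "E = ?f ` touchings \<union> ?g ` touchings"
  proof safe
    fix A i B j assume e: "((A, i), (B, j)) \<in> E" "((A, i), (B, j)) \<notin> ?g ` touchings"
    then show "((A, i), (B, j)) \<in> ?f ` touchings" unfolding E_def by (cases i) force+
  qed (auto simp: E_def)
  moreover have "?f ` touchings \<inter> ?g ` touchings = {}" by auto
  moreover have "card (?f ` touchings) = card touchings" "card (?g ` touchings) = card touchings"
    by (rule card_image, auto simp: inj_on_def)+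
  ultimately show ?thesis using finite_touchings by (simp add: card_Un_disjoint)
qed

lemma card_touching_pairs_le: "card (touching_pairs S) \<le> card touchings"
proof (rule surj_card_le[OF finite_touchings])
  show "touching_pairs S \<subseteq> (\<lambda>(A, B). {A, B}) ` touchings"
  proof
    fix t assume "t \<in> touching_pairs S"
    then obtain A B where t: "t = {A, B}" and AB: "A \<in> S" "B \<in> S" "A \<noteq> B" "touch A B"
      unfolding touching_pairs_def by auto
    then have "above A B \<or> above B A" using touch_imp_above x_monotone by blast
    then have "(A, B) \<in> touchings \<or> (B, A) \<in> touchings" using AB touch_sym unfolding touchings_def by auto
    then show "t \<in> (\<lambda>(A, B). {A, B}) ` touchings" using t by (auto simp: insert_commute intro: rev_image_eqI)
  qed
qed

lemma card_touching_pairs_le_sq: "card (touching_pairs S) \<le> (card S)\<^sup>2"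
proof -
  have "touching_pairs S \<subseteq> (\<lambda>(A, B). {A, B}) ` (S \<times> S)" unfolding touching_pairs_def by auto
  then have "card (touching_pairs S) \<le> card (S \<times> S)" using finite_S by (intro surj_card_le) auto
  then show ?thesis by (simp add: card_cartesian_product power2_eq_square)
qed

lemma card_V: "card V = 2 * card S"
  unfolding V_def by (simp add: card_cartesian_product)

lemma finite_crossing_points: "finite (crossing_points S)"
proof -
  have "crossing_points S \<subseteq> (\<Union>(A, B)\<in>{(A, B). A \<in> S \<and> B \<in> S \<and> A \<noteq> B}. A \<inter> B)"
    unfolding crossing_points_def by auto
  moreover have "finite {(A, B). A \<in> S \<and> B \<in> S \<and> A \<noteq> B}"
    by (rule finite_subset[of _ "S \<times> S"]) (auto simp: finite_S)
  ultimately show ?thesis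
    using general_position unfolding general_position_def by (elim finite_subset) auto
qed

text \<open>By general position a crossing point lies on exactly two curves of the family, which are
  counted in both orders.\<close>

lemma sum_card_crossings_le:
  "(\<Sum>(A, B)\<in>{(A, B). A \<in> S \<and> B \<in> S \<and> A \<noteq> B}. card (crossings A B)) \<le> 2 * card (crossing_points S)"
proof -
  let ?D = "{(A, B). A \<in> S \<and> B \<in> S \<and> A \<noteq> B}"
  let ?T = "Sigma ?D (\<lambda>(A, B). crossings A B)"
  have finD: "finite ?D" by (rule finite_subset[of _ "S \<times> S"]) (auto simp: finite_S)
  have fin: "\<forall>e\<in>?D. finite (case e of (A, B) \<Rightarrow> crossings A B)" using finite_crossings by auto
  have finT: "finite ?T" using finD fin by (intro finite_SigmaI) auto
  have "(\<Sum>(A, B)\<in>?D. card (crossings A B)) = card ?T"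
    using finD fin by (subst card_SigmaI) (auto intro: sum.cong)
  also have "\<dots> = (\<Sum>p\<in>crossing_points S. card {t \<in> ?T. snd t = p})"
  proof -
    have "snd ` ?T \<subseteq> crossing_points S"
    proof (rule image_subsetI)
      fix t assume "t \<in> ?T"
      then obtain A B p where t: "t = ((A, B), p)" "A \<in> S" "B \<in> S" "A \<noteq> B" "p \<in> crossings A B" by auto
      then show "snd t \<in> crossing_points S" unfolding crossing_points_def crossings_def by fastforce
    qed
    from sum.group[OF finT finite_crossing_points this, of "\<lambda>_. 1::nat"] show ?thesis by simp
  qed
  also have "\<dots> \<le> (\<Sum>p\<in>crossing_points S. 2)"
  proof (rule sum_mono)
    fix p assume "p \<in> crossing_points S"
    then obtain A B where AB: "A \<in> S" "B \<in> S" "A \<noteq> B" "p \<in> A" "p \<in> B" unfolding crossing_points_def by blast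
    have only: "C = A \<or> C = B" if "C \<in> S" "p \<in> C" for C
      using general_position AB that unfolding general_position_def by blast
    have "{t \<in> ?T. snd t = p} \<subseteq> {((A, B), p), ((B, A), p)}"
    proof
      fix t assume t: "t \<in> {t \<in> ?T. snd t = p}"
      obtain C D q where eq: "t = ((C, D), q)" by (metis prod.exhaust)
      have qp: "q = p" using t unfolding eq by simp
      have "C \<in> S" "D \<in> S" "C \<noteq> D" "p \<in> C" "p \<in> D"
        using t unfolding eq qp crossings_def by simp_all
      then show "t \<in> {((A, B), p), ((B, A), p)}" using only[of C] only[of D] eq qp by auto
    qed
    then have "card {t \<in> ?T. snd t = p} \<le> card {((A, B), p), ((B, A), p)}" by (intro card_mono) auto
    also have "\<dots> \<le> 2" by (simp add: card_insert_le_m1)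
    finally show "card {t \<in> ?T. snd t = p} \<le> 2" .
  qed
  finally show ?thesis by simp
qed

text \<open>The two flags and the two orders of a pair account for the factor 4. Each ordered pair
  with a flag has at most four end positions, hence 8.\<close>

lemma card_pierces_le:
  "card (pierced_graph.pierces V P) \<le> 4 * card (crossing_points S) + 8 * (card S)\<^sup>2"
proof -
  \<comment> \<open>The piercings do not depend on the window parameters, so both are set to
    1.\<close>
  interpret pierced_graph V E \<tau> P 1 1 by (rule pierced_graph) auto
  let ?D = "{(A, B). A \<in> S \<and> B \<in> S \<and> A \<noteq> B}"
  let ?P = "\<lambda>(i, A, B). P (A, i) (B, i)" and ?I = "(UNIV :: bool set) \<times> ?D"
  have finD: "finite ?D" by (rule finite_subset[of _ "S \<times> S"]) (auto simp: finite_S)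
  have "pierces \<subseteq> (\<lambda>((i, A, B), p). ((A, i), (B, i), p)) ` Sigma ?I ?P"
  proof
    fix t assume "t \<in> pierces"
    then obtain A i B j p where t: "t = ((A, i), (B, j), p)" "p \<in> P (A, i) (B, j)"
      unfolding pierces_def by auto
    then have "i = j" "(A, B) \<in> ?D" unfolding P_def V_def by (auto split: if_splits)
    then show "t \<in> (\<lambda>((i, A, B), p). ((A, i), (B, i), p)) ` Sigma ?I ?P"
      using t by (intro rev_image_eqI[of "((i, A, B), p)"]) auto
  qed
  then have "card pierces \<le> card (Sigma ?I ?P)"
    using finD finite_P by (intro surj_card_le) auto
  also have "\<dots> = (\<Sum>e\<in>?I. card (?P e))"
    using finD finite_P by (intro card_SigmaI) auto
  also have "\<dots> \<le> (\<Sum>e\<in>?I. card (crossings (fst (snd e)) (snd (snd e))) + 4)"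
  proof (rule sum_mono)
    fix e assume "e \<in> ?I"
    then obtain i A B where e: "e = (i, A, B)" "A \<in> S" "B \<in> S" "A \<noteq> B" by auto
    have "card (?P e) \<le> card (pos ` fst ` crossings A B \<union> ends (A, i) \<union> ends (B, i))"
      using e finite_crossings by (intro card_mono) (auto simp: P_def ends_def)
    also have "\<dots> \<le> card (pos ` fst ` crossings A B) + card (ends (A, i)) + card (ends (B, i))"
      using card_Un_le[of "pos ` fst ` crossings A B \<union> ends (A, i)" "ends (B, i)"]
        card_Un_le[of "pos ` fst ` crossings A B" "ends (A, i)"] by linarith
    also have "\<dots> \<le> card (crossings A B) + 2 + 2"
    proof (intro add_mono)
      show "card (pos ` fst ` crossings A B) \<le> card (crossings A B)"
        using finite_crossings e by (metis card_image_le finite_imageI le_trans)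
    qed (simp_all add: ends_def card_insert_le_m1)
    finally show "card (?P e) \<le> card (crossings (fst (snd e)) (snd (snd e))) + 4" using e by simp
  qed
  also have "\<dots> = (\<Sum>i\<in>(UNIV :: bool set). \<Sum>(A, B)\<in>?D. card (crossings A B) + 4)"
    by (subst sum.cartesian_product) (auto intro: sum.cong)
  also have "\<dots> = 2 * (\<Sum>(A, B)\<in>?D. card (crossings A B)) + 8 * card ?D"
    by (simp add: sum.distrib case_prod_beta)
  also have "\<dots> \<le> 2 * (2 * card (crossing_points S)) + 8 * (card S)\<^sup>2"
  proof (intro add_mono mult_left_mono sum_card_crossings_le)
    have "card ?D \<le> card (S \<times> S)" using finite_S by (intro card_mono) auto
    then show "card ?D \<le> (card S)\<^sup>2" by (simp add: card_cartesian_product power2_eq_square)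
  qed auto
  finally show ?thesis by simp
qed

end

section \<open>From piercings to crossing points; small families\<close>

theorem corollary5:
  "\<exists>C>0. \<exists>c>0. \<forall>(S :: (real \<times> real) set set) (n :: nat) (\<epsilon> :: real).
     finite S \<and> card S = n \<and> n \<ge> 3 \<and>
     (\<forall>A\<in>S. x_monotone_curve A) \<and> general_position S \<and>
     real (card (touching_pairs S)) \<ge> \<epsilon> * real n ^ 2 \<and>
     \<epsilon> > C * sqrt (ln (ln (real n)) / ln (real n)) \<longrightarrow>
     real (card (crossing_points S)) \<ge>
       c * \<epsilon> * real n ^ 2 * sqrt (ln (real n) / ln (ln (real n)))"
proof -
  obtain n0 where n0: "\<And>(V :: ((real \<times> real) set \<times> bool) set) E \<tau> P (n::nat). n0 \<le> n \<Longrightarrow>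
     (\<forall>K s. 0 < K \<longrightarrow> 0 < s \<longrightarrow> pierced_graph V E \<tau> P K s) \<Longrightarrow>
     (\<forall>b u. (b, u) \<in> E \<longrightarrow> \<tau> b u < card E) \<Longrightarrow> card V \<le> 2 * n \<Longrightarrow>
     2 * (real n)\<^sup>2 \<le> card E * sqrt (ln n) \<Longrightarrow>
     card E * sqrt (ln n / ln (ln n)) \<le> 900 * real (card (pierced_graph.pierces V P))"
    using card_pierces_ge_asymptotically[where 'v = "(real \<times> real) set \<times> bool"] by blast
  define R where "R = (\<lambda>n::nat. sqrt (ln (real n) / ln (ln (real n))))"
  \<comment> \<open>For \<open>n > 27\<close>, a cube of 3, \<open>ln (ln n)\<close> is at least 1.
    The sum in \<open>C\<close> rules out \<open>n <= N\<close>: there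
    \<open>C < \<epsilon> * R n\<close> forces \<open>\<epsilon> > 1\<close>, but there are at most
    \<open>n^2\<close> touching pairs. The summand 7200 is 900 * 8, the cost of the end
    positions.\<close>
  define N where "N = max n0 27"
  define C where "C = 7200 + (\<Sum>n\<in>{3..N}. R n)"
  have ln3: "1 < ln (3 :: real)"
  proof -
    have "exp 1 < (3 :: real)" using e_less_272 by simp
    then have "ln (exp 1) < ln (3 :: real)" by (subst ln_less_cancel_iff) auto
    then show ?thesis by simp
  qed
  have ln1: "1 < ln (real n)" if "3 \<le> n" for n
  proof -
    have "ln 3 \<le> ln (real n)" using that by (subst ln_le_cancel_iff) auto
    then show ?thesis using ln3 by linarith
  qed
  have lnln: "0 < ln (ln (real n))" if "3 \<le> n" for n
    using ln1[OF that] by simp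
  have R0: "0 < R n" if "3 \<le> n" for n
    unfolding R_def using ln1[OF that] lnln[OF that] by simp
  have "0 \<le> (\<Sum>n\<in>{3..N}. R n)" by (intro sum_nonneg) (simp add: R0 less_imp_le)
  then have C: "7200 \<le> C" unfolding C_def by simp
  show ?thesis
  proof (rule exI[of _ C], rule conjI[OF _ exI[of _ "1 / 3600"]], goal_cases)
    case 1
    show ?case using C by simp
  next
    case 2
    show ?case
    proof (intro conjI allI impI)
      fix S :: "(real \<times> real) set set" and n :: nat and \<epsilon> :: real
      assume A: "finite S \<and> card S = n \<and> n \<ge> 3 \<and> (\<forall>A\<in>S. x_monotone_curve A) \<and> general_position S \<and>
       real (card (touching_pairs S)) \<ge> \<epsilon> * real n ^ 2 \<and> \<epsilon> > C * sqrt (ln (ln (real n)) / ln (real n))"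
      interpret curve_family S using A by unfold_locales auto
      have n: "card S = n" "3 \<le> n" using A by auto
      have tp: "\<epsilon> * real n ^ 2 \<le> card (touching_pairs S)" using A by simp
      have n2: "0 < (real n)\<^sup>2" using n by simp
      have "sqrt (ln (ln (real n)) / ln (real n)) = 1 / R n"
        unfolding R_def by (simp add: real_sqrt_divide)
      then have "C / R n < \<epsilon>" using A by simp
      then have \<epsilon>R: "C < \<epsilon> * R n" using R0[OF n(2)] by (simp add: divide_less_eq)
      have \<epsilon>0: "0 < \<epsilon>" using \<epsilon>R C R0[OF n(2)] by (smt (verit) mult_nonpos_nonneg)
      have nN: "N < n"
      proof (rule ccontr)
        assume "\<not> N < n"
        then have "R n \<le> (\<Sum>n\<in>{3..N}. R n)"
          using n R0 by (intro member_le_sum) (auto simp: less_imp_le)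
        then have "R n \<le> C" unfolding C_def by simp
        then have "1 * R n < \<epsilon> * R n" using \<epsilon>R by simp
        then have "1 < \<epsilon>" using R0[OF n(2)] by (simp only: mult_less_cancel_right_pos)
        then have "1 * (real n)\<^sup>2 < \<epsilon> * (real n)\<^sup>2" using n2 by (intro mult_strict_right_mono) auto
        also have "\<dots> \<le> (real n)\<^sup>2"
          using tp card_touching_pairs_le_sq n(1) by (metis of_nat_le_iff of_nat_power order_trans)
        finally show False by simp
      qed
      have lnln1: "1 \<le> ln (ln (real n))"
      proof -
        have "ln 27 = 3 * ln (3 :: real)" using ln_realpow[of "3 :: real" 3] by simp
        moreover have "ln 27 \<le> ln (real n)" using nN unfolding N_def by (subst ln_le_cancel_iff) auto
        ultimately have "3 \<le> ln (real n)" using ln3 by linarith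
        then have "ln 3 \<le> ln (ln (real n))" by (subst ln_le_cancel_iff) auto
        then show ?thesis using ln3 by linarith
      qed
      have mE: "2 * (\<epsilon> * (real n)\<^sup>2) \<le> card E"
        using tp card_touching_pairs_le unfolding card_E by simp
      have "1 \<le> \<epsilon> * sqrt (ln n)"
      proof -
        have "R n \<le> sqrt (ln n)" unfolding R_def using lnln1 ln1[OF n(2)]
          by (intro real_sqrt_le_mono) (simp add: divide_le_eq)
        then have "\<epsilon> * R n \<le> \<epsilon> * sqrt (ln n)" using \<epsilon>0 by (intro mult_left_mono) auto
        then show ?thesis using \<epsilon>R C by linarith
      qed
      then have "2 * (real n)\<^sup>2 * 1 \<le> 2 * (real n)\<^sup>2 * (\<epsilon> * sqrt (ln n))" by (intro mult_left_mono) auto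
      also have "\<dots> = 2 * (\<epsilon> * (real n)\<^sup>2) * sqrt (ln n)" by simp
      also have "\<dots> \<le> card E * sqrt (ln n)" using mE ln1[OF n(2)] by (intro mult_right_mono) auto
      finally have m_ge: "2 * (real n)\<^sup>2 \<le> card E * sqrt (ln n)" by simp
      have "card E * R n \<le> 900 * real (card (pierced_graph.pierces V P))"
        unfolding R_def
      proof (rule n0[OF _ _ _ _ m_ge])
        show "n0 \<le> n" using nN unfolding N_def by simp
        show "\<forall>K s. 0 < K \<longrightarrow> 0 < s \<longrightarrow> pierced_graph V E \<tau> P K s" using pierced_graph by simp
        show "\<forall>b u. (b, u) \<in> E \<longrightarrow> \<tau> b u < card E" using \<tau>_less_card unfolding card_E by fastforce
        show "card V \<le> 2 * n" unfolding card_V n ..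
      qed
      also have "\<dots> \<le> 900 * (4 * real (card (crossing_points S)) + 8 * (real n)\<^sup>2)"
        using of_nat_mono[OF card_pierces_le, where 'a = real] n(1) by (intro mult_left_mono) auto
      finally have "card E * R n \<le> 3600 * real (card (crossing_points S)) + 7200 * (real n)\<^sup>2" by simp
      moreover have "2 * (\<epsilon> * (real n)\<^sup>2) * R n \<le> card E * R n"
        using mE R0[OF n(2)] by (intro mult_right_mono) auto
      moreover have "7200 * (real n)\<^sup>2 \<le> (\<epsilon> * R n) * (real n)\<^sup>2"
        using \<epsilon>R C by (intro mult_right_mono) auto
      \<comment> \<open>One half of \<open>2 * \<epsilon> * n^2 * R n\<close> absorbs the term
        \<open>7200 * n^2\<close>; the other half remains, and 3600 is 900 * 4.\<close>
      ultimately have "\<epsilon> * (real n)\<^sup>2 * R n \<le> 3600 * real (card (crossing_points S))"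
        by (simp add: mult_ac)
      then show "1 / 3600 * \<epsilon> * real n ^ 2 * sqrt (ln (real n) / ln (ln (real n))) \<le> real (card (crossing_points S))"
        unfolding R_def by simp
    qed simp
  qed
qed

end
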